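(* Let $f_1(t)$ and $f_2(t)$ be two solutions of the one-dimensional Boltzmann equation $$\frac{\partial f}{\partial t}=\tilde Q_\lambda(f,f)$$ corresponding to initial values $f_1^0$ and $f_2^0$ in $\mathcal P_2(\mathbb R_+)$ having the same mean value, $\int_{\mathbb R_+} v\,f_1^0(v)\,dv=\int_{\mathbb R_+} v\,f_2^0(v)\,dv=\bar m$. Then, for all times $t\ge 0$, $$W_2^2(f_1(t),f_2(t))\le \exp\{\mathfrak S(2)\,t\}\,W_2^2(f_1^0,f_2^0),\qquad \mathfrak S(2)=2\lambda(\lambda-1)+\beta^2 .$$ If $\beta^2<2\lambda(1-\lambda)$, then $\mathfrak S(2)<0$, and the Wasserstein metric $W_2(f_1(t),f_2(t))$ decays exponentially to zero in time.
   Context: Let $0\le\lambda\le1$, $p=\lambda$, $q=1-\lambda$, and let $\eta$ be a real random variable with law a probability measure $\mu$ supported in $[-\lambda,+\infty)$, with mean zero and variance $\beta^2$. $\langle\cdot\rangle$ denotes expectation with respect to $\eta$, i.e. integration against $\mu$. Write $\mathfrak S(s):=\langle (p+\eta)^s\rangle+q^s-1$ for $s\ge1$, so that $\mathfrak S(2)=\langle(p+\eta)^2\rangle+q^2-1=2\lambda(\lambda-1)+\beta^2$. $\mathcal P_2(\mathbb R_+)$ is the set of Borel probability measures on $\mathbb R_+=[0,\infty)$ with finite second moment (written as densities, $f(v)\,dv$, even if not absolutely continuous). The collision operator is defined weakly, for test functions $\varphi$ (e.g. bounded continuous), by $$(\varphi,\tilde Q_\lambda(f,f))=\Big\langle\int_{\mathbb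 R_+}\int_{\mathbb R_+} f(v)f(w)\big[\varphi((p+\eta)v+qw)-\varphi(v)\big]\,dv\,dw\Big\rangle ,$$ and a solution is a time-dependent probability measure $f(t)$ satisfying $\frac{d}{dt}\int\varphi f(t)=(\varphi,\tilde Q_\lambda(f(t),f(t)))$ for all such $\varphi$, with the prescribed initial value. Equivalently, $\partial_t f=\langle f_{p+\eta}*f_q\rangle-f$, where $f_p(v)=\frac1p f(v/p)$. $W_2(f,g)=\inf_{\Pi}\big(\iint |v-x|^2\,d\Pi(v,x)\big)^{1/2}$, the infimum being over all joint probability measures $\Pi$ with marginals $f$ and $g$. *)

theory Defs
  imports "HOL-Probability.Probability"
begin

text \<open>
  Measures on \<open>[0,\<infinity>)\<close> are represented as measures on the Borel sets of \<open>real\<close> that are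
  concentrated on the nonnegative half-line.
\<close>

definition prob_halfline :: "real measure set" where
  "prob_halfline = {f. prob_space f \<and> sets f = sets borel \<and> (AE v in f. 0 \<le> v)}"

definition P2 :: "real measure set" where
  "P2 = {f \<in> prob_halfline. integrable f (\<lambda>v. v\<^sup>2)}"

definition collision_weak ::
    "real \<Rightarrow> real measure \<Rightarrow> real measure \<Rightarrow> (real \<Rightarrow> real) \<Rightarrow> real" where
  "collision_weak lam mu f \<phi> =
     (\<integral>\<eta>. (\<integral>v. (\<integral>w. \<phi> ((lam + \<eta>) * v + (1 - lam) * w) - \<phi> v \<partial>f) \<partial>f) \<partial>mu)"

text \<open>
  The test functions are the bounded continuous functions on the whole line; every bounded
  continuous function on \<open>[0,\<infinity>)\<close> is the restriction of one, and only its values there matter.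
  The derivative at time \<open>0\<close> is one-sided. No moment of \<open>f t\<close> is assumed finite for \<open>t > 0\<close>.
\<close>

definition boltzmann_solution ::
    "real \<Rightarrow> real measure \<Rightarrow> real measure \<Rightarrow> (real \<Rightarrow> real measure) \<Rightarrow> bool" where
  "boltzmann_solution lam mu f0 f \<longleftrightarrow>
     f 0 = f0 \<and>
     (\<forall>t\<ge>0. f t \<in> prob_halfline) \<and>
     (\<forall>\<phi>. continuous_on UNIV \<phi> \<and> bounded (range \<phi>) \<longrightarrow>
        (\<forall>t\<ge>0. ((\<lambda>s. \<integral>v. \<phi> v \<partial>f s) has_real_derivative
                  collision_weak lam mu (f t) \<phi>) (at t within {0..})))"

text \<open>
  The integrand \<open>(lam + \<eta>) powr s\<close> is only relevant for \<open>lam + \<eta> \<ge> 0\<close>, where for \<open>s \<ge> 1\<close> it is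
  the usual power (including the value \<open>0\<close> at \<open>0\<close>).
\<close>

definition spectral_fun :: "real \<Rightarrow> real measure \<Rightarrow> real \<Rightarrow> real" where
  "spectral_fun lam mu s = (\<integral>\<eta>. (lam + \<eta>) powr s \<partial>mu) + (1 - lam) powr s - 1"

definition couplings :: "real measure \<Rightarrow> real measure \<Rightarrow> (real \<times> real) measure set" where
  "couplings f g = {\<pi>. prob_space \<pi> \<and> sets \<pi> = sets (borel \<Otimes>\<^sub>M borel) \<and>
                        distr \<pi> borel fst = f \<and> distr \<pi> borel snd = g}"

definition ennreal_sqrt :: "ennreal \<Rightarrow> ennreal" where
  "ennreal_sqrt x = (if x = \<infinity> then \<infinity> else ennreal (sqrt (enn2real x)))"

text \<open>
  The distance takes values in \<open>[0,\<infinity>]\<close>, so that it is not given a spurious finite value on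
  measures without a finite second moment.
\<close>

definition W2 :: "real measure \<Rightarrow> real measure \<Rightarrow> ennreal" where
  "W2 f g = (INF \<pi>\<in>couplings f g. ennreal_sqrt (\<integral>\<^sup>+(v, x). ennreal (\<bar>v - x\<bar>\<^sup>2) \<partial>\<pi>))"

end

theory Submission
  imports Defs
begin

text \<open>
  The inequality comes from letting an initial coupling evolve by the same kinetic equation as its
  marginals. Let \<open>\<pi>\<close> couple \<open>f01\<close> and \<open>f02\<close>, and let a pair collide with
  an independent pair by the rule \<open>x, y \<mapsto> (lam + \<eta>) x + (1 - lam) y\<close> on the plane, with one
  \<open>\<eta>\<close> for both coordinates. Because the rule is linear, each marginal of the evolved law
  \<open>\<Pi> t\<close> solves the equation on the line. Weak solutions on the line are unique
  (\<open>weak_evolution_unique\<close>), so \<open>\<Pi> t\<close> is a coupling of \<open>f1 t\<close> and \<open>f2 t\<close>, and its cost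
  bounds \<open>W2 (f1 t) (f2 t)\<close>.

  The cost is the second moment of the linear functional \<open>U (v, x) = v - x\<close>. The equality of the
  initial means says that \<open>U\<close> has mean zero under \<open>\<pi>\<close>. Since \<open>\<eta>\<close> has mean zero, collisions
  preserve this, the mixed terms in the square vanish, and one collision multiplies the second
  moment of \<open>U\<close> by \<open>\<langle>(lam + \<eta>)\<^sup>2\<rangle> + (1 - lam)\<^sup>2\<close>, called \<open>energy_factor\<close> below
  (\<open>centred_gain\<close>).

  The law \<open>\<Pi> t\<close> is constructed as a Wild sum
  \<open>\<Sum>n. exp (- t) * (1 - exp (- t))^n * W n\<close>, where \<open>W 0 = \<pi>\<close> and \<open>W (n + 1)\<close> is the average over
  \<open>j \<le> n\<close> of the laws produced by colliding \<open>W j\<close> with \<open>W (n - j)\<close>. With \<open>s\<close> the energy factor, the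
  second moment of \<open>U\<close> under \<open>W n\<close> is \<open>pochhammer s n / n!\<close> times its initial value, and these
  numbers are the coefficients of \<open>(1 - z) powr (- s)\<close>. At \<open>z = 1 - exp (- t)\<close> the sum is therefore
  exactly \<open>exp ((s - 1) * t)\<close> times the initial cost (\<open>wild_sum_second_moment\<close>), and \<open>s - 1\<close> is
  \<open>spectral_fun lam mu 2\<close>. The infimum over \<open>\<pi>\<close> gives the theorem.
\<close>

section \<open>Integrals of bounded functions\<close>

lemma in_prob_borel: "M \<in> space (prob_algebra borel) \<longleftrightarrow> prob_space M \<and> sets M = sets borel"
  by (auto simp: space_prob_algebra)

lemma abs_integral_le_prob:
  assumes "prob_space M" "\<And>x. \<bar>f x\<bar> \<le> (B::real)"
  shows "\<bar>\<integral>x. f x \<partial>M\<bar> \<le> B"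
proof -
  interpret prob_space M by fact
  have B: "0 \<le> B" using assms(2)[of undefined] by linarith
  show ?thesis
  proof (cases "integrable M f")
    case True
    have "\<bar>\<integral>x. f x \<partial>M\<bar> \<le> (\<integral>x. \<bar>f x\<bar> \<partial>M)" by (rule integral_abs_bound)
    also have "\<dots> \<le> (\<integral>x. B \<partial>M)" using True assms(2) by (intro integral_mono) auto
    finally show ?thesis by (simp add: prob_space)
  qed (simp add: not_integrable_integral_eq B)
qed

lemma integrable_bounded:
  assumes "prob_space M" "f \<in> borel_measurable M" "\<And>x. \<bar>f x\<bar> \<le> (B::real)"
  shows "integrable M f"
proof -
  interpret prob_space M by fact
  show ?thesis using assms by (intro integrable_const_bound[of _ B]) auto
qed

lemma integral_swap_bounded:
  assumes "prob_space M" "prob_space N"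
    and "case_prod f \<in> borel_measurable (M \<Otimes>\<^sub>M N)" "\<And>x y. \<bar>f x y\<bar> \<le> (B::real)"
  shows "(\<integral>x. \<integral>y. f x y \<partial>N \<partial>M) = (\<integral>y. \<integral>x. f x y \<partial>M \<partial>N)"
proof -
  interpret M: prob_space M by fact
  interpret N: prob_space N by fact
  interpret pair_prob_space M N ..
  have "integrable (M \<Otimes>\<^sub>M N) (case_prod f)"
    using assms prob_space_axioms by (intro integrable_bounded[of _ _ B]) auto
  from Fubini_integral[OF this] show ?thesis by simp
qed

lemma continuous_on_integral_bounded:
  fixes g :: "'b::metric_space \<Rightarrow> 'c \<Rightarrow> real"
  assumes "prob_space M" and "\<And>y. g y \<in> borel_measurable M"
    and "\<And>x. continuous_on UNIV (\<lambda>y. g y x)" and "\<And>y x. \<bar>g y x\<bar> \<le> B"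
  shows "continuous_on UNIV (\<lambda>y. \<integral>x. g y x \<partial>M)"
proof -
  interpret prob_space M by fact
  have "(\<lambda>n. \<integral>x. g (X n) x \<partial>M) \<longlonglongrightarrow> (\<integral>x. g y x \<partial>M)" if "X \<longlonglongrightarrow> y" for X y
  proof (rule integral_dominated_convergence[where w="\<lambda>_. B"])
    have "(\<lambda>n. g (X n) x) \<longlonglongrightarrow> g y x" for x
      by (rule continuous_on_tendsto_compose[OF assms(3)[of x] that]) auto
    then show "AE x in M. (\<lambda>n. g (X n) x) \<longlonglongrightarrow> g y x" by simp
  qed (use assms in auto)
  then show ?thesis unfolding continuous_on_sequentially o_def by blast
qed

section \<open>The gain operator\<close>

text \<open>
  The law of \<open>(lam + \<eta>) x + (1 - lam) y\<close> for independent \<open>x\<close>, \<open>y\<close>, \<open>\<eta>\<close>. It is defined on every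
  Euclidean space because the same operator acts on a coupling, which lives on the plane, and on its
  marginals, which live on the line.
\<close>

definition gain :: "real \<Rightarrow> real measure \<Rightarrow> 'a::euclidean_space measure \<Rightarrow> 'a measure \<Rightarrow> 'a measure" where
  "gain lam mu M N = distr (M \<Otimes>\<^sub>M (N \<Otimes>\<^sub>M mu)) borel (\<lambda>(x, y, \<eta>). (lam + \<eta>) *\<^sub>R x + (1 - lam) *\<^sub>R y)"

locale random_collision =
  fixes lam :: real and mu :: "real measure"
  assumes mu_prob: "prob_space mu" and sets_mu [measurable_cong]: "sets mu = sets borel"
begin

lemma gain_measurable:
  fixes M N :: "'a::euclidean_space measure"
  assumes "sets M = sets borel" "sets N = sets borel"
  shows "(\<lambda>(x, y, \<eta>). (lam + \<eta>) *\<^sub>R x + (1 - lam) *\<^sub>R y) \<in> borel_measurable (M \<Otimes>\<^sub>M (N \<Otimes>\<^sub>M mu))"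
proof -
  note [measurable_cong] = assms
  show ?thesis by measurable
qed

lemma gain_in_prob:
  fixes M N :: "'a::euclidean_space measure"
  assumes "M \<in> space (prob_algebra borel)" "N \<in> space (prob_algebra borel)"
  shows "gain lam mu M N \<in> space (prob_algebra borel)"
proof -
  interpret M: prob_space M using assms by (simp add: in_prob_borel)
  interpret N: prob_space N using assms by (simp add: in_prob_borel)
  interpret mu: prob_space mu by (rule mu_prob)
  interpret Nmu: pair_prob_space N mu ..
  interpret MNmu: pair_prob_space M "N \<Otimes>\<^sub>M mu" ..
  show ?thesis
    unfolding in_prob_borel gain_def
    using assms by (auto simp: in_prob_borel intro!: MNmu.prob_space_distr gain_measurable)
qed

lemma nn_integral_gain:
  fixes M N :: "'a::euclidean_space measure"
  assumes "M \<in> space (prob_algebra borel)" "N \<in> space (prob_algebra borel)"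
    and f [measurable]: "f \<in> borel_measurable borel"
  shows "(\<integral>\<^sup>+z. f z \<partial>gain lam mu M N)
       = (\<integral>\<^sup>+x. \<integral>\<^sup>+y. \<integral>\<^sup>+\<eta>. f ((lam + \<eta>) *\<^sub>R x + (1 - lam) *\<^sub>R y) \<partial>mu \<partial>N \<partial>M)"
proof -
  interpret M: prob_space M using assms by (simp add: in_prob_borel)
  interpret N: prob_space N using assms by (simp add: in_prob_borel)
  interpret mu: prob_space mu by (rule mu_prob)
  interpret Nmu: pair_prob_space N mu ..
  have [measurable_cong]: "sets M = sets borel" "sets N = sets borel"
    using assms by (auto simp: in_prob_borel)
  have "(\<integral>\<^sup>+z. f z \<partial>gain lam mu M N)
      = (\<integral>\<^sup>+w. f ((lam + snd (snd w)) *\<^sub>R fst w + (1 - lam) *\<^sub>R fst (snd w)) \<partial>(M \<Otimes>\<^sub>M (N \<Otimes>\<^sub>M mu)))"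
    unfolding gain_def by (subst nn_integral_distr) (auto simp: case_prod_beta)
  also have "\<dots> = (\<integral>\<^sup>+x. \<integral>\<^sup>+w. f ((lam + snd w) *\<^sub>R x + (1 - lam) *\<^sub>R fst w) \<partial>(N \<Otimes>\<^sub>M mu) \<partial>M)"
    by (subst Nmu.nn_integral_fst[symmetric]) auto
  also have "\<dots> = (\<integral>\<^sup>+x. \<integral>\<^sup>+y. \<integral>\<^sup>+\<eta>. f ((lam + \<eta>) *\<^sub>R x + (1 - lam) *\<^sub>R y) \<partial>mu \<partial>N \<partial>M)"
    by (subst mu.nn_integral_fst[symmetric]) auto
  finally show ?thesis .
qed

text \<open>
  Fubini for a possibly unbounded integrand. The inner product integral splits only for almost every
  \<open>x\<close>, which is why the two parts are separate; the unbounded case is needed for the mean of a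
  linear functional.
\<close>

lemma integral_gain:
  fixes M N :: "'a::euclidean_space measure" and f :: "'a \<Rightarrow> real"
  assumes "M \<in> space (prob_algebra borel)" "N \<in> space (prob_algebra borel)"
    and f: "integrable (gain lam mu M N) f"
  shows "(\<integral>z. f z \<partial>gain lam mu M N)
       = (\<integral>x. \<integral>w. f ((lam + snd w) *\<^sub>R x + (1 - lam) *\<^sub>R fst w) \<partial>(N \<Otimes>\<^sub>M mu) \<partial>M)"
    and "AE x in M. (\<integral>w. f ((lam + snd w) *\<^sub>R x + (1 - lam) *\<^sub>R fst w) \<partial>(N \<Otimes>\<^sub>M mu))
       = (\<integral>y. \<integral>\<eta>. f ((lam + \<eta>) *\<^sub>R x + (1 - lam) *\<^sub>R y) \<partial>mu \<partial>N)"
proof -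
  interpret M: prob_space M using assms by (simp add: in_prob_borel)
  interpret N: prob_space N using assms by (simp add: in_prob_borel)
  interpret mu: prob_space mu by (rule mu_prob)
  interpret Nmu: pair_prob_space N mu ..
  interpret MNmu: pair_prob_space M "N \<Otimes>\<^sub>M mu" ..
  have [measurable_cong]: "sets M = sets borel" "sets N = sets borel"
    using assms by (auto simp: in_prob_borel)
  have fm [measurable]: "f \<in> borel_measurable borel"
    using borel_measurable_integrable[OF f] by (simp add: gain_def)
  have int: "integrable (M \<Otimes>\<^sub>M (N \<Otimes>\<^sub>M mu))
      (\<lambda>(x, w). f ((lam + snd w) *\<^sub>R x + (1 - lam) *\<^sub>R fst w))"
    using f unfolding gain_def by (subst (asm) integrable_distr_eq) (auto simp: case_prod_unfold)
  have "(\<integral>z. f z \<partial>gain lam mu M N)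
      = (\<integral>w. f ((lam + snd (snd w)) *\<^sub>R fst w + (1 - lam) *\<^sub>R fst (snd w)) \<partial>(M \<Otimes>\<^sub>M (N \<Otimes>\<^sub>M mu)))"
    unfolding gain_def by (subst integral_distr) (auto simp: case_prod_beta)
  then show "(\<integral>z. f z \<partial>gain lam mu M N)
       = (\<integral>x. \<integral>w. f ((lam + snd w) *\<^sub>R x + (1 - lam) *\<^sub>R fst w) \<partial>(N \<Otimes>\<^sub>M mu) \<partial>M)"
    using MNmu.integral_fst'[OF int] by (simp add: case_prod_unfold)
  show "AE x in M. (\<integral>w. f ((lam + snd w) *\<^sub>R x + (1 - lam) *\<^sub>R fst w) \<partial>(N \<Otimes>\<^sub>M mu))
       = (\<integral>y. \<integral>\<eta>. f ((lam + \<eta>) *\<^sub>R x + (1 - lam) *\<^sub>R y) \<partial>mu \<partial>N)"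
    using MNmu.AE_integrable_fst'[OF int]
  proof (rule AE_mp, intro AE_I2 impI)
    fix x assume "integrable (N \<Otimes>\<^sub>M mu) (\<lambda>y. case (x, y) of (x, w) \<Rightarrow> f ((lam + snd w) *\<^sub>R x + (1 - lam) *\<^sub>R fst w))"
    from Nmu.integral_fst'[OF this]
    show "(\<integral>w. f ((lam + snd w) *\<^sub>R x + (1 - lam) *\<^sub>R fst w) \<partial>(N \<Otimes>\<^sub>M mu))
       = (\<integral>y. \<integral>\<eta>. f ((lam + \<eta>) *\<^sub>R x + (1 - lam) *\<^sub>R y) \<partial>mu \<partial>N)" by simp
  qed
qed

definition noise_avg :: "('a::euclidean_space \<Rightarrow> real) \<Rightarrow> 'a \<Rightarrow> 'a \<Rightarrow> real" where
  "noise_avg f x y = (\<integral>\<eta>. f ((lam + \<eta>) *\<^sub>R x + (1 - lam) *\<^sub>R y) \<partial>mu)"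

lemma avg_measurable [measurable]:
  assumes [measurable]: "f \<in> borel_measurable borel"
  shows "(\<lambda>w. noise_avg f (fst w) (snd w)) \<in> borel_measurable (borel \<Otimes>\<^sub>M borel)"
proof -
  interpret mu: prob_space mu by (rule mu_prob)
  show ?thesis unfolding noise_avg_def by measurable
qed

lemma abs_avg_le:
  assumes "\<And>x. \<bar>f x\<bar> \<le> B"
  shows "\<bar>noise_avg f x y\<bar> \<le> B"
  unfolding noise_avg_def using mu_prob assms by (rule abs_integral_le_prob)

text \<open>
  Both orders of integration are kept: freezing one argument of the gain operator leaves an
  integral of a bounded function against the other one. The bilinear estimates below
  change one argument at a time.
\<close>

lemma integral_gain_bounded:
  fixes M N :: "'a::euclidean_space measure" and f :: "'a \<Rightarrow> real"
  assumes MN: "M \<in> space (prob_algebra borel)" "N \<in> space (prob_algebra borel)"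
    and f [measurable]: "f \<in> borel_measurable borel" and B: "\<And>x. \<bar>f x\<bar> \<le> B"
  shows "(\<integral>z. f z \<partial>gain lam mu M N) = (\<integral>x. \<integral>y. noise_avg f x y \<partial>N \<partial>M)"
    and "(\<integral>z. f z \<partial>gain lam mu M N) = (\<integral>y. \<integral>x. noise_avg f x y \<partial>M \<partial>N)"
proof -
  interpret M: prob_space M using assms by (simp add: in_prob_borel)
  interpret N: prob_space N using assms by (simp add: in_prob_borel)
  interpret MN: pair_prob_space M N ..
  interpret mu: prob_space mu by (rule mu_prob)
  have [measurable_cong]: "sets M = sets borel" "sets N = sets borel"
    using assms by (auto simp: in_prob_borel)
  have "integrable (gain lam mu M N) f"
    using gain_in_prob[OF MN] B by (intro integrable_bounded) (auto simp: in_prob_borel gain_def)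
  note * = integral_gain[OF MN this]
  have [measurable]: "(\<lambda>x. noise_avg f (fst x) (snd x)) \<in> borel_measurable (M \<Otimes>\<^sub>M N)"
    by measurable
  have 2: "(\<integral>x. \<integral>w. f ((lam + snd w) *\<^sub>R x + (1 - lam) *\<^sub>R fst w) \<partial>(N \<Otimes>\<^sub>M mu) \<partial>M)
    = (\<integral>x. \<integral>y. noise_avg f x y \<partial>N \<partial>M)"
  proof (rule integral_cong_AE)
    interpret Nmu: pair_prob_space N mu ..
    show "(\<lambda>x. \<integral>w. f ((lam + snd w) *\<^sub>R x + (1 - lam) *\<^sub>R fst w) \<partial>(N \<Otimes>\<^sub>M mu)) \<in> borel_measurable M"
      by measurable
    have "(\<lambda>x. \<integral>y. noise_avg f (fst (x,y)) (snd (x,y)) \<partial>N) \<in> borel_measurable M"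
      by measurable
    then show "(\<lambda>x. \<integral>y. noise_avg f x y \<partial>N) \<in> borel_measurable M" by simp
    show "AE x in M. (\<integral>w. f ((lam + snd w) *\<^sub>R x + (1 - lam) *\<^sub>R fst w) \<partial>(N \<Otimes>\<^sub>M mu)) = (\<integral>y. noise_avg f x y \<partial>N)"
      using *(2) by (simp add: noise_avg_def)
  qed
  show 1: "(\<integral>z. f z \<partial>gain lam mu M N) = (\<integral>x. \<integral>y. noise_avg f x y \<partial>N \<partial>M)"
    using *(1) 2 by simp
  show "(\<integral>z. f z \<partial>gain lam mu M N) = (\<integral>y. \<integral>x. noise_avg f x y \<partial>M \<partial>N)"
    unfolding 1 using abs_avg_le[OF B]
    by (intro integral_swap_bounded[where B=B])
       (auto simp: case_prod_beta M.prob_space_axioms N.prob_space_axioms)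
qed

text \<open>
  The collision rule commutes with linear maps, so projecting a coupling to a marginal commutes with
  the gain operator. This is what makes the marginals of an evolved coupling solve the
  equation on the line.
\<close>

lemma gain_distr_linear:
  fixes M N :: "'a::euclidean_space measure" and L :: "'a \<Rightarrow> 'b::euclidean_space"
  assumes MN: "M \<in> space (prob_algebra borel)" "N \<in> space (prob_algebra borel)"
    and L: "bounded_linear L"
  shows "distr (gain lam mu M N) borel L = gain lam mu (distr M borel L) (distr N borel L)"
proof (rule measure_eqI)
  interpret L: bounded_linear L by fact
  interpret M: prob_space M using assms by (simp add: in_prob_borel)
  interpret N: prob_space N using assms by (simp add: in_prob_borel)
  interpret mu: prob_space mu by (rule mu_prob)
  have [measurable]: "L \<in> borel_measurable borel"
    by (intro borel_measurable_continuous_onI L.continuous_on continuous_on_id)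
  have [measurable_cong]: "sets M = sets borel" "sets N = sets borel"
    using assms by (auto simp: in_prob_borel)
  have D: "distr M borel L \<in> space (prob_algebra borel)" "distr N borel L \<in> space (prob_algebra borel)"
    by (auto simp: in_prob_borel intro!: M.prob_space_distr N.prob_space_distr)
  fix X assume "X \<in> sets (distr (gain lam mu M N) borel L)"
  then have [measurable]: "X \<in> sets borel" by simp
  have [measurable_cong]: "sets (gain lam mu M N) = sets borel" by (simp add: gain_def)
  have "emeasure (distr (gain lam mu M N) borel L) X = (\<integral>\<^sup>+z. indicator X (L z) \<partial>gain lam mu M N)"
    by (subst nn_integral_indicator[symmetric], simp, subst nn_integral_distr) auto
  also have "\<dots> = (\<integral>\<^sup>+z. indicator X z \<partial>gain lam mu (distr M borel L) (distr N borel L))"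
    by (simp add: nn_integral_gain[OF MN] nn_integral_gain[OF D] nn_integral_distr L.add L.scaleR)
  also have "\<dots> = emeasure (gain lam mu (distr M borel L) (distr N borel L)) X"
    by (rule nn_integral_indicator) (simp add: gain_def)
  finally show "emeasure (distr (gain lam mu M N) borel L) X = emeasure (gain lam mu (distr M borel L) (distr N borel L)) X" .
qed (simp add: gain_def)

lemma collision_weak_eq:
  fixes M :: "real measure"
  assumes M: "M \<in> space (prob_algebra borel)"
    and f [measurable]: "f \<in> borel_measurable borel" and B: "\<And>x. \<bar>f x\<bar> \<le> B"
  shows "collision_weak lam mu M f = (\<integral>z. f z \<partial>gain lam mu M M) - (\<integral>v. f v \<partial>M)"
proof -
  interpret M: prob_space M using assms by (simp add: in_prob_borel)
  interpret mu: prob_space mu by (rule mu_prob)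
  have [measurable_cong]: "sets M = sets borel" using assms by (auto simp: in_prob_borel)
  have iM: "g \<in> borel_measurable M \<Longrightarrow> (\<And>x. \<bar>g x\<bar> \<le> B) \<Longrightarrow> integrable M g" for g
    by (intro integrable_bounded M.prob_space_axioms)
  have le: "\<bar>\<integral>x. g x \<partial>M\<bar> \<le> B" if "\<And>x. \<bar>g x\<bar> \<le> B" for g
    using M.prob_space_axioms that by (rule abs_integral_le_prob)
  let ?h = "\<lambda>\<eta> v w. f ((lam + \<eta>) * v + (1 - lam) * w)"
  have "collision_weak lam mu M f = (\<integral>\<eta>. (\<integral>v. (\<integral>w. ?h \<eta> v w \<partial>M) - f v \<partial>M) \<partial>mu)"
    unfolding collision_weak_def
    by (intro Bochner_Integration.integral_cong refl, subst Bochner_Integration.integral_diff)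
       (auto intro!: iM B simp: M.prob_space)
  also have "\<dots> = (\<integral>\<eta>. (\<integral>v. (\<integral>w. ?h \<eta> v w \<partial>M) \<partial>M) - (\<integral>v. f v \<partial>M) \<partial>mu)"
    by (intro Bochner_Integration.integral_cong refl, subst Bochner_Integration.integral_diff)
       (auto intro!: iM B le)
  also have "\<dots> = (\<integral>\<eta>. (\<integral>v. (\<integral>w. ?h \<eta> v w \<partial>M) \<partial>M) \<partial>mu) - (\<integral>v. f v \<partial>M)"
    by (subst Bochner_Integration.integral_diff)
       (auto intro!: integrable_bounded[of _ _ B] mu_prob B le simp: mu.prob_space)
  also have "(\<integral>\<eta>. (\<integral>v. (\<integral>w. ?h \<eta> v w \<partial>M) \<partial>M) \<partial>mu) = (\<integral>v. (\<integral>\<eta>. (\<integral>w. ?h \<eta> v w \<partial>M) \<partial>mu) \<partial>M)"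
    by (intro integral_swap_bounded[where B=B] mu_prob M.prob_space_axioms B le) measurable
  also have "\<dots> = (\<integral>v. (\<integral>w. noise_avg f v w \<partial>M) \<partial>M)"
    unfolding noise_avg_def real_scaleR_def
    by (intro Bochner_Integration.integral_cong refl integral_swap_bounded[where B=B]
        mu_prob M.prob_space_axioms B) measurable
  also have "\<dots> = (\<integral>z. f z \<partial>gain lam mu M M)"
    using integral_gain_bounded(1)[OF M M f B] by simp
  finally show ?thesis .
qed

end

section \<open>Uniqueness of weak solutions on the line\<close>

text \<open>
  The weak equation for probability measures on the whole line, the setting shared by the given
  solutions and the marginals of a Wild sum that are to be compared with them.
\<close>

definition weak_evolution :: "real \<Rightarrow> real measure \<Rightarrow> (real \<Rightarrow> real measure) \<Rightarrow> bool" where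
  "weak_evolution lam mu F \<longleftrightarrow>
     (\<forall>t\<ge>0. F t \<in> space (prob_algebra borel)) \<and>
     (\<forall>\<phi>. continuous_on UNIV \<phi> \<and> bounded (range \<phi>) \<longrightarrow>
        (\<forall>t\<ge>0. ((\<lambda>s. \<integral>v. \<phi> v \<partial>F s) has_real_derivative
                  collision_weak lam mu (F t) \<phi>) (at t within {0..})))"

context random_collision
begin

lemma continuous_on_avg:
  fixes f :: "real \<Rightarrow> real"
  assumes f: "continuous_on UNIV f" and B: "\<And>x. \<bar>f x\<bar> \<le> B"
  shows "continuous_on UNIV (\<lambda>x. noise_avg f x y)" "continuous_on UNIV (\<lambda>y. noise_avg f x y)"
proof -
  have [measurable]: "f \<in> borel_measurable borel"
    using f by (rule borel_measurable_continuous_onI)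
  show "continuous_on UNIV (\<lambda>x. noise_avg f x y)"
    unfolding noise_avg_def
    by (rule continuous_on_integral_bounded[OF mu_prob, where B=B])
       (auto intro!: B continuous_on_compose2[OF f] continuous_intros)
  show "continuous_on UNIV (\<lambda>y. noise_avg f x y)"
    unfolding noise_avg_def
    by (rule continuous_on_integral_bounded[OF mu_prob, where B=B])
       (auto intro!: B continuous_on_compose2[OF f] continuous_intros)
qed

text \<open>
  The gain operator is Lipschitz with constant 2 in the distance dual to bounded continuous
  functions. Averaging a test function over one argument and the noise gives
  again a continuous function with the same bound, so the two arguments can be exchanged one after the
  other.
\<close>

lemma gain_diff_le:
  fixes F G :: "real measure" and f :: "real \<Rightarrow> real"
  assumes FG: "F \<in> space (prob_algebra borel)" "G \<in> space (prob_algebra borel)"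
    and f: "continuous_on UNIV f" and B: "\<And>x. \<bar>f x\<bar> \<le> 1"
    and dist: "\<And>\<psi>. continuous_on UNIV \<psi> \<Longrightarrow> (\<And>x. \<bar>\<psi> x\<bar> \<le> 1) \<Longrightarrow> \<bar>(\<integral>x. \<psi> x \<partial>F) - (\<integral>x. \<psi> x \<partial>G)\<bar> \<le> d"
  shows "\<bar>(\<integral>z. f z \<partial>gain lam mu F F) - (\<integral>z. f z \<partial>gain lam mu G G)\<bar> \<le> 2 * d"
proof -
  have fm [measurable]: "f \<in> borel_measurable borel"
    using f by (rule borel_measurable_continuous_onI)
  have F: "prob_space F" and G: "prob_space G" and
    [measurable_cong]: "sets F = sets borel" "sets G = sets borel"
    using FG by (auto simp: in_prob_borel)
  have am: "(\<lambda>x. noise_avg f x y) \<in> borel_measurable borel" "(\<lambda>y. noise_avg f x y) \<in> borel_measurable borel" for x y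
    using continuous_on_avg[OF f B] by (auto intro!: borel_measurable_continuous_onI)
  let ?\<psi>1 = "\<lambda>x. \<integral>y. noise_avg f x y \<partial>F" and ?\<psi>2 = "\<lambda>y. \<integral>x. noise_avg f x y \<partial>G"
  have "continuous_on UNIV ?\<psi>1"
    by (intro continuous_on_integral_bounded[where B=1] F continuous_on_avg[OF f B] abs_avg_le B)
       (use am in simp)
  moreover have "\<bar>?\<psi>1 x\<bar> \<le> 1" for x
    by (intro abs_integral_le_prob F abs_avg_le B)
  ultimately have 1: "\<bar>(\<integral>x. ?\<psi>1 x \<partial>F) - (\<integral>x. ?\<psi>1 x \<partial>G)\<bar> \<le> d" by (rule dist)
  have "continuous_on UNIV ?\<psi>2"
    by (intro continuous_on_integral_bounded[where B=1] G continuous_on_avg[OF f B] abs_avg_le B)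
       (use am in simp)
  moreover have "\<bar>?\<psi>2 x\<bar> \<le> 1" for x
    by (intro abs_integral_le_prob G abs_avg_le B)
  ultimately have 2: "\<bar>(\<integral>x. ?\<psi>2 x \<partial>F) - (\<integral>x. ?\<psi>2 x \<partial>G)\<bar> \<le> d" by (rule dist)
  have "(\<integral>x. ?\<psi>1 x \<partial>G) = (\<integral>x. ?\<psi>2 x \<partial>F)"
    using integral_gain_bounded[OF FG(2,1) fm B] by simp
  then show ?thesis
    using 1 2 integral_gain_bounded(1)[OF FG(1,1) fm B] integral_gain_bounded(2)[OF FG(2,2) fm B]
    by simp
qed

text \<open>
  Iterated Gronwall estimate. The derivative of \<open>exp s\<close> times the difference of the two integrals
  contains only the gain terms, to which the Lipschitz bound and the previous estimate apply. The
  induction treats each test function separately, because the supremum over test functions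
  need not be differentiable in time.
\<close>

lemma weak_evolution_gronwall:
  assumes ev: "weak_evolution lam mu F" "weak_evolution lam mu G" and init: "F 0 = G 0"
    and f: "continuous_on UNIV f" and B: "\<And>x. \<bar>f x\<bar> \<le> 1" and t: "0 \<le> t"
  shows "\<bar>(\<integral>x. f x \<partial>F t) - (\<integral>x. f x \<partial>G t)\<bar> \<le> 2 * (2 * t)^n / fact n * exp t"
  using f B t
proof (induction n arbitrary: f t)
  case 0
  have "\<bar>\<integral>x. f x \<partial>F t\<bar> \<le> 1" "\<bar>\<integral>x. f x \<partial>G t\<bar> \<le> 1"
    using ev 0 by (auto intro!: abs_integral_le_prob simp: weak_evolution_def in_prob_borel)
  moreover have "1 \<le> exp t" using 0 by simp
  ultimately have "\<bar>(\<integral>x. f x \<partial>F t) - (\<integral>x. f x \<partial>G t)\<bar> \<le> 2 * exp t" by linarith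
  then show ?case by simp
next
  case (Suc n)
  show ?case
  proof (cases "t = 0")
    case True then show ?thesis by (simp add: init)
  next
    case False
    with Suc have t: "0 < t" by simp
    let ?I = "\<lambda>s. (\<integral>x. f x \<partial>F s) - (\<integral>x. f x \<partial>G s)"
    let ?D = "\<lambda>s. (\<integral>x. f x \<partial>gain lam mu (F s) (F s)) - (\<integral>x. f x \<partial>gain lam mu (G s) (G s))"
    have fb: "bounded (range f)" using Suc.prems(2) by (auto simp: bounded_iff)
    have fm: "f \<in> borel_measurable borel"
      using Suc.prems(1) by (rule borel_measurable_continuous_onI)
    have FG: "F s \<in> space (prob_algebra borel)" "G s \<in> space (prob_algebra borel)" if "0 \<le> s" for s
      using ev that by (auto simp: weak_evolution_def)
    have I': "(?I has_real_derivative ?D s - ?I s) (at s within {0..})" if s: "0 \<le> s" for s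
    proof -
      have "(?I has_real_derivative collision_weak lam mu (F s) f - collision_weak lam mu (G s) f) (at s within {0..})"
        using ev Suc.prems(1) fb s by (intro DERIV_diff) (auto simp: weak_evolution_def)
      then show ?thesis
        by (simp add: collision_weak_eq[OF FG(1)[OF s] fm Suc.prems(2)]
           collision_weak_eq[OF FG(2)[OF s] fm Suc.prems(2)] algebra_simps)
    qed
    have E': "((\<lambda>s. exp s * ?I s) has_real_derivative exp s * ?D s) (at s within {0..})" if s: "0 \<le> s" for s
      by (rule DERIV_cong[OF DERIV_mult[OF DERIV_subset[OF DERIV_exp] I'[OF s]]]) (auto simp: algebra_simps)
    have D: "\<bar>?D s\<bar> \<le> 2 * (2 * (2 * s)^n / fact n * exp s)" if s: "0 \<le> s" for s
      using Suc.IH s by (intro gain_diff_le FG Suc.prems) auto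
    \<comment> \<open>The comparison function carries \<open>exp (2 * s)\<close>: the estimate to be shown, multiplied by
      \<open>exp s\<close>.\<close>
    have "norm (exp t * ?I t - exp 0 * ?I 0) \<le> 2 * (2 * t)^Suc n / fact (Suc n) * exp (2 * t) - 2 * (2 * 0)^Suc n / fact (Suc n) * exp (2 * 0)"
    proof (rule differentiable_bound_general[OF t])
      show "continuous_on {0..t} (\<lambda>s. exp s * ?I s)"
        by (rule continuous_on_subset[OF DERIV_continuous_on[OF E']]) auto
      show "continuous_on {0..t} (\<lambda>s. 2 * (2 * s)^Suc n / fact (Suc n) * exp (2 * s))"
        by (intro continuous_intros) auto
      fix s assume s: "0 < s" "s < t"
      have "at s within {0..} = at s"
        using s by (intro at_within_interior) auto
      then show "((\<lambda>s. exp s * ?I s) has_vector_derivative exp s * ?D s) (at s)"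
        using E'[of s] s by (simp add: has_real_derivative_iff_has_vector_derivative)
      show "((\<lambda>s. 2 * (2 * s)^Suc n / fact (Suc n) * exp (2 * s)) has_vector_derivative
         4 * (2 * s)^n / fact n * exp (2 * s) + 2 * (2 * s)^Suc n / fact (Suc n) * (2 * exp (2 * s))) (at s)"
        unfolding has_real_derivative_iff_has_vector_derivative[symmetric]
      proof -
        have "((\<lambda>s. (2 * s)^Suc n * exp (2 * s)) has_real_derivative
            2 * (real n + 1) * (2 * s)^n * exp (2 * s) + (2 * s)^Suc n * (2 * exp (2 * s))) (at s)"
          by (rule derivative_eq_intros refl)+ (simp add: algebra_simps)
        from DERIV_cmult[OF this, of "2 / fact (Suc n)"]
        have "((\<lambda>s. 2 / fact (Suc n) * ((2 * s)^Suc n * exp (2 * s))) has_real_derivative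
         4 * (2 * s)^n / fact n * exp (2 * s) + 2 * (2 * s)^Suc n / fact (Suc n) * (2 * exp (2 * s))) (at s)"
          by (rule DERIV_cong) (simp add: divide_simps distrib_left, simp add: algebra_simps)
        then show "((\<lambda>s. 2 * (2 * s)^Suc n / fact (Suc n) * exp (2 * s)) has_real_derivative
         4 * (2 * s)^n / fact n * exp (2 * s) + 2 * (2 * s)^Suc n / fact (Suc n) * (2 * exp (2 * s))) (at s)"
          by (simp only: times_divide_eq_left times_divide_eq_right mult.assoc)
      qed
      have "norm (exp s * ?D s) \<le> exp s * (2 * (2 * (2 * s)^n / fact n * exp s))"
        using mult_left_mono[OF D[of s], of "exp s"] s by (simp add: abs_mult)
      also have "\<dots> = 4 * (2 * s)^n / fact n * exp (2 * s)"
        by (simp add: mult_exp_exp)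
      also have "\<dots> \<le> 4 * (2 * s)^n / fact n * exp (2 * s) + 2 * (2 * s)^Suc n / fact (Suc n) * (2 * exp (2 * s))"
        using s by simp
      finally show "norm (exp s * ?D s) \<le> 4 * (2 * s)^n / fact n * exp (2 * s) + 2 * (2 * s)^Suc n / fact (Suc n) * (2 * exp (2 * s))" .
    qed
    moreover have "exp (2 * t) = exp t * exp t" by (simp flip: exp_add)
    ultimately have "exp t * \<bar>?I t\<bar> \<le> exp t * (2 * (2 * t)^Suc n / fact (Suc n) * exp t)"
      by (simp add: init abs_mult mult_ac)
    then show ?thesis by (rule mult_left_le_imp_le) simp
  qed
qed

text \<open>
  The bound of the iterated estimate is a term of an exponential series and tends to 0, so all
  bounded continuous functions have equal integrals. Cosines and sines among them
  determine the characteristic function, hence the measure.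
\<close>

theorem weak_evolution_unique:
  assumes ev: "weak_evolution lam mu F" "weak_evolution lam mu G" and init: "F 0 = G 0" and t: "0 \<le> t"
  shows "F t = G t"
proof (rule Levy_uniqueness)
  have FG: "F t \<in> space (prob_algebra borel)" "G t \<in> space (prob_algebra borel)"
    using ev t by (auto simp: weak_evolution_def)
  then show "real_distribution (F t)" "real_distribution (G t)"
    by (auto simp: in_prob_borel real_distribution_def real_distribution_axioms_def dest: sets_eq_imp_space_eq)
  have eq: "(\<integral>x. f x \<partial>F t) = (\<integral>x. f x \<partial>G t)" if f: "continuous_on UNIV f" "\<And>x. \<bar>f x\<bar> \<le> 1" for f :: "real \<Rightarrow> real"
  proof -
    have "(\<lambda>n. (2 * t)^n /\<^sub>R fact n) \<longlonglongrightarrow> 0"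
      by (rule summable_LIMSEQ_zero[OF summable_exp_generic])
    then have lim: "(\<lambda>n. 2 * ((2 * t)^n /\<^sub>R fact n) * exp t) \<longlonglongrightarrow> 2 * 0 * exp t"
      by (intro tendsto_intros)
    moreover have "\<bar>(\<integral>x. f x \<partial>F t) - (\<integral>x. f x \<partial>G t)\<bar> \<le> 2 * ((2 * t)^n /\<^sub>R fact n) * exp t" for n
      using weak_evolution_gronwall[OF ev init f t, of n] by (simp add: divide_inverse mult_ac)
    ultimately have "\<bar>(\<integral>x. f x \<partial>F t) - (\<integral>x. f x \<partial>G t)\<bar> \<le> 2 * 0 * exp t"
      by (intro LIMSEQ_le_const[OF lim]) blast
    then show ?thesis by simp
  qed
  have int: "integrable M (\<lambda>x. cos (u * x))" "integrable M (\<lambda>x. sin (u * x))" if "M \<in> space (prob_algebra borel)"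
    for u and M :: "real measure"
  proof -
    have "prob_space M" and [measurable_cong]: "sets M = sets borel" using that by (auto simp: in_prob_borel)
    then show "integrable M (\<lambda>x. cos (u * x))" "integrable M (\<lambda>x. sin (u * x))"
      by (auto intro!: integrable_bounded[of _ _ 1])
  qed
  have char: "char M u = Complex (\<integral>x. cos (u * x) \<partial>M) (\<integral>x. sin (u * x) \<partial>M)" if M: "M \<in> space (prob_algebra borel)"
    for u and M :: "real measure"
  proof -
    have "exp (\<i> * complex_of_real r) = complex_of_real (cos r) + \<i> * complex_of_real (sin r)" for r
      by (simp add: complex_eq_iff Re_exp Im_exp)
    then have "char M u = (\<integral>x. complex_of_real (cos (u * x)) + \<i> * complex_of_real (sin (u * x)) \<partial>M)"
      unfolding char_def by (simp del: of_real_mult)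
    also have "\<dots> = complex_of_real (\<integral>x. cos (u * x) \<partial>M) + \<i> * complex_of_real (\<integral>x. sin (u * x) \<partial>M)"
      using int[OF M] by (subst Bochner_Integration.integral_add) auto
    finally show ?thesis by (simp add: Complex_eq)
  qed
  show "char (F t) = char (G t)"
    by (rule ext) (simp add: char[OF FG(1)] char[OF FG(2)] eq continuous_intros)
qed

end

section \<open>Mixtures and geometric weights\<close>

lemma kernel_measurable:
  fixes p :: "nat pmf"
  assumes "\<And>n. K n \<in> space (prob_algebra borel)"
  shows "K \<in> measurable (measure_pmf p) (subprob_algebra borel)"
  using assms by (auto simp: space_prob_algebra space_subprob_algebra prob_space_imp_subprob_space)

lemma bind_pmf_in_prob:
  fixes p :: "nat pmf"
  assumes K: "\<And>n. K n \<in> space (prob_algebra borel)"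
  shows "measure_pmf p \<bind> K \<in> space (prob_algebra borel)"
proof -
  have "sets (measure_pmf p \<bind> K) = sets borel"
    using K by (intro sets_bind) (auto simp: space_prob_algebra)
  moreover have "prob_space (measure_pmf p \<bind> K)"
    using K by (intro measure_pmf.prob_space_bind[OF _ kernel_measurable[OF K]])
       (auto simp: space_prob_algebra)
  ultimately show ?thesis by (simp add: space_prob_algebra)
qed

lemma integral_bind_pmf:
  fixes p :: "nat pmf" and f :: "'a::topological_space \<Rightarrow> real"
  assumes K: "\<And>n. K n \<in> space (prob_algebra borel)"
    and f: "f \<in> borel_measurable borel" and B: "\<And>x. \<bar>f x\<bar> \<le> B"
  shows "(\<integral>x. f x \<partial>(measure_pmf p \<bind> K)) = (\<integral>n. \<integral>x. f x \<partial>K n \<partial>measure_pmf p)"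
proof (rule integral_bind[OF f _ kernel_measurable[OF K], where B'=1])
  show "AE n in measure_pmf p. emeasure (K n) (space (K n)) \<le> ennreal 1"
    using K by (auto simp: space_prob_algebra prob_space.emeasure_space_1)
qed (use B in \<open>auto intro: measure_pmf.finite_measure_axioms\<close>)

lemma geometric_expectation:
  fixes a :: "nat \<Rightarrow> real"
  assumes p: "0 < p" "p \<le> 1" and B: "\<And>n. \<bar>a n\<bar> \<le> B"
  shows "(\<integral>n. a n \<partial>geometric_pmf p) = p * (\<Sum>n. a n * (1 - p)^n)"
proof -
  have B0: "0 \<le> B" using B[of 0] by linarith
  have s: "summable (\<lambda>n. B * (1 - p)^n)"
    using p by (intro summable_mult summable_geometric) auto
  have n: "summable (\<lambda>n. norm (a n * (1 - p)^n))"
    by (rule summable_comparison_test[OF _ s]) (use p B in \<open>auto simp: abs_mult intro!: mult_right_mono\<close>)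
  have 1: "summable (\<lambda>n. norm (p * (a n * (1 - p)^n)))"
    using summable_mult[OF n, of "\<bar>p\<bar>"] by (simp only: real_norm_def abs_mult)
  have 2: "summable (\<lambda>n. a n * (1 - p)^n)" using n by (rule summable_norm_cancel)
  have int: "integrable (count_space UNIV) (\<lambda>n. p * (a n * (1 - p)^n))"
    using 1 by (simp only: integrable_count_space_nat_iff)
  have "(\<integral>n. a n \<partial>geometric_pmf p) = (\<integral>n. pmf (geometric_pmf p) n * a n \<partial>count_space UNIV)"
    unfolding measure_pmf_eq_density by (subst integral_density) auto
  also have "\<dots> = (\<integral>n. p * (a n * (1 - p)^n) \<partial>count_space UNIV)"
    using p by (simp add: mult_ac)
  also have "\<dots> = (\<Sum>n. p * (a n * (1 - p)^n))"
    using int by (rule integral_count_space_nat)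
  also have "\<dots> = p * (\<Sum>n. a n * (1 - p)^n)" using 2 by (rule suminf_mult)
  finally show ?thesis .
qed

text \<open>
  The Cauchy product for a bilinear term that need not factorise: both sides sum
  \<open>G j k * z^(j + k)\<close> over all pairs, along the diagonals and along the rows. Dominated by a double
  geometric series, the family is summable and may be rearranged.
\<close>

lemma suminf_triangle:
  fixes G :: "nat \<Rightarrow> nat \<Rightarrow> real"
  assumes z: "0 \<le> z" "z < 1" and B: "\<And>j k. \<bar>G j k\<bar> \<le> B"
  shows "(\<Sum>n. (\<Sum>j\<le>n. G j (n - j)) * z^n) = (\<Sum>j. (\<Sum>k. G j k * z^k) * z^j)"
proof -
  have B0: "0 \<le> B" using B[of 0 0] by linarith
  let ?f = "\<lambda>(j, k). G j k * z^k * z^j"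
  have geo: "(\<lambda>k. c * z^k) summable_on UNIV" if "0 \<le> c" for c
    using z that by (intro norm_summable_imp_summable_on) (auto simp: abs_mult intro!: summable_mult summable_geometric)
  have sum: "infsum h (UNIV :: nat set) = (\<Sum>n. h n)" if "h summable_on UNIV" for h :: "nat \<Rightarrow> real"
    using has_sum_imp_sums[OF has_sum_infsum[OF that]] by (simp add: sums_iff)
  have "(\<lambda>(j, k). B * z^k * z^j) summable_on (UNIV \<times> (UNIV :: nat set))"
  proof (rule summable_on_SigmaI)
    show "((\<lambda>k. case (j, k) of (j, k) \<Rightarrow> B * z^k * z^j) has_sum infsum (\<lambda>k. B * z^k) UNIV * z^j) UNIV" for j
      using has_sum_cmult_left[OF has_sum_infsum[OF geo[OF B0]]] by simp
    show "(\<lambda>j. infsum (\<lambda>k. B * z^k) UNIV * z^j) summable_on (UNIV :: nat set)"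
      by (intro geo infsum_nonneg) (use z B0 in auto)
  qed (use z B0 in auto)
  then have f: "?f summable_on (UNIV \<times> UNIV)"
    by (rule abs_summable_summable[OF summable_on_comparison_test])
       (use z B in \<open>auto simp: abs_mult intro!: mult_right_mono\<close>)
  have row: "(\<lambda>k. G j k * z^k) summable_on UNIV" for j
    by (rule abs_summable_summable[OF summable_on_comparison_test[OF geo[OF B0]]])
       (use z B in \<open>auto simp: abs_mult intro!: mult_right_mono\<close>)
  have bij: "bij_betw (\<lambda>(n, j). (j, n - j)) (SIGMA n:UNIV. {..n}) (UNIV \<times> (UNIV :: nat set))"
    by (rule bij_betw_byWitness[where f'="\<lambda>(j, k). (j + k, j)"]) auto
  have f': "(\<lambda>(n, j). G j (n - j) * z^n) summable_on (SIGMA n:UNIV. {..n})"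
  proof -
    have "(\<lambda>x. ?f ((\<lambda>(n, j). (j, n - j)) x)) summable_on (SIGMA n:UNIV. {..n})"
      using summable_on_reindex_bij_betw[OF bij, of ?f] f by simp
    also have "?this \<longleftrightarrow> ?thesis"
      by (intro summable_on_cong) (auto simp: mult.assoc power_add[symmetric])
    finally show ?thesis .
  qed
  have "(\<Sum>\<^sub>\<infinity>n. \<Sum>\<^sub>\<infinity>j\<in>{..n}. G j (n - j) * z^n) = infsum (\<lambda>(n, j). G j (n - j) * z^n) (SIGMA n:UNIV. {..n})"
    using infsum_Sigma_banach[OF f'] by simp
  also have "\<dots> = infsum (\<lambda>x. ?f ((\<lambda>(n, j). (j, n - j)) x)) (SIGMA n:UNIV. {..n})"
    by (intro infsum_cong) (auto simp: mult.assoc power_add[symmetric])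
  also have "\<dots> = infsum ?f (UNIV \<times> UNIV)" by (rule infsum_reindex_bij_betw[OF bij])
  also have "\<dots> = (\<Sum>\<^sub>\<infinity>j. \<Sum>\<^sub>\<infinity>k. G j k * z^k * z^j)"
    using infsum_Sigma_banach[OF f] by simp
  also have "\<dots> = (\<Sum>\<^sub>\<infinity>j. (\<Sum>\<^sub>\<infinity>k. G j k * z^k) * z^j)"
    by (intro infsum_cong infsum_cmult_left row)
  finally have eq: "(\<Sum>\<^sub>\<infinity>n. (\<Sum>j\<le>n. G j (n - j)) * z^n) = (\<Sum>\<^sub>\<infinity>j. (\<Sum>k. G j k * z^k) * z^j)"
    by (simp add: sum[OF row] sum_distrib_right)
  have 1: "(\<lambda>n. (\<Sum>j\<le>n. G j (n - j)) * z^n) summable_on UNIV"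
    using summable_on_Sigma_banach[OF f'] by (simp add: sum_distrib_right)
  have 2: "(\<lambda>j. (\<Sum>k. G j k * z^k) * z^j) summable_on UNIV"
    using summable_on_Sigma_banach[OF f] by (simp add: sum[OF row, symmetric] infsum_cmult_left[OF row])
  show ?thesis using eq by (simp only: sum[OF 1] sum[OF 2])
qed

section \<open>Wild sums\<close>

text \<open>
  The index \<open>j\<close> is uniform on \<open>{..n}\<close>, so the value \<open>P\<close> for \<open>j > n\<close> carries no mass. The case
  distinction makes the family a kernel of probability measures on all indices and supplies the bound on which
  termination of the recursion rests.
\<close>

fun wild :: "real \<Rightarrow> real measure \<Rightarrow> 'a::euclidean_space measure \<Rightarrow> nat \<Rightarrow> 'a measure" where
  "wild lam mu P 0 = P"
| "wild lam mu P (Suc n) = measure_pmf (pmf_of_set {..n}) \<bind>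
     (\<lambda>j. if j \<le> n then gain lam mu (wild lam mu P j) (wild lam mu P (n - j)) else P)"

text \<open>
  The geometric distribution with parameter \<open>exp (- t)\<close> gives exactly the weights
  \<open>exp (- t) * (1 - exp (- t))^n\<close> of the Wild expansion.
\<close>

definition wild_sum :: "real \<Rightarrow> real measure \<Rightarrow> 'a::euclidean_space measure \<Rightarrow> real \<Rightarrow> 'a measure" where
  "wild_sum lam mu P t = measure_pmf (geometric_pmf (exp (- t))) \<bind> wild lam mu P"

context random_collision
begin

lemma wild_in_prob:
  assumes "P \<in> space (prob_algebra borel)"
  shows "wild lam mu P n \<in> space (prob_algebra borel)"
proof (induction n rule: less_induct)
  case (less n)
  show ?case
  proof (cases n)
    case 0 then show ?thesis using assms by simp
  next
    case (Suc m)
    then show ?thesis using less assms by (auto intro!: bind_pmf_in_prob gain_in_prob)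
  qed
qed

lemma wild_sum_in_prob:
  assumes "P \<in> space (prob_algebra borel)"
  shows "wild_sum lam mu P t \<in> space (prob_algebra borel)"
  unfolding wild_sum_def using wild_in_prob[OF assms] by (rule bind_pmf_in_prob)

lemma wild_sum_0: "P \<in> space (prob_algebra borel) \<Longrightarrow> wild_sum lam mu P 0 = P"
  unfolding wild_sum_def using wild_in_prob[of P]
  by (simp add: return_pmf.rep_eq bind_return[where N=borel] space_prob_algebra space_subprob_algebra prob_space_imp_subprob_space)

lemma integral_wild_Suc:
  fixes f :: "'a::euclidean_space \<Rightarrow> real"
  assumes P: "P \<in> space (prob_algebra borel)"
    and f: "f \<in> borel_measurable borel" and B: "\<And>x. \<bar>f x\<bar> \<le> B"
  shows "real (Suc n) * (\<integral>x. f x \<partial>wild lam mu P (Suc n))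
     = (\<Sum>j\<le>n. \<integral>x. f x \<partial>gain lam mu (wild lam mu P j) (wild lam mu P (n - j)))"
proof -
  have K: "(if j \<le> n then gain lam mu (wild lam mu P j) (wild lam mu P (n - j)) else P) \<in> space (prob_algebra borel)" for j
    using P by (auto intro!: gain_in_prob wild_in_prob)
  show ?thesis
    using integral_bind_pmf[OF K f B] by (simp add: integral_pmf_of_set del: of_nat_Suc)
qed

lemma integral_gain_bind_pmf:
  fixes f :: "'a::euclidean_space \<Rightarrow> real" and p :: "nat pmf"
  assumes K: "\<And>n. K n \<in> space (prob_algebra borel)"
    and f [measurable]: "f \<in> borel_measurable borel" and B: "\<And>x. \<bar>f x\<bar> \<le> B"
  shows "(\<integral>z. f z \<partial>gain lam mu (measure_pmf p \<bind> K) (measure_pmf p \<bind> K))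
    = (\<integral>j. \<integral>k. \<integral>z. f z \<partial>gain lam mu (K j) (K k) \<partial>measure_pmf p \<partial>measure_pmf p)"
proof -
  let ?M = "measure_pmf p \<bind> K"
  have M: "?M \<in> space (prob_algebra borel)" by (rule bind_pmf_in_prob[OF K])
  have avg_m [measurable]: "(\<lambda>w. noise_avg f (fst w) (snd w)) \<in> borel_measurable (borel \<Otimes>\<^sub>M borel)"
    by (rule avg_measurable[OF f])
  have m: "(\<lambda>x. \<integral>y. noise_avg f x y \<partial>N) \<in> borel_measurable borel" "(\<lambda>y. \<integral>x. noise_avg f x y \<partial>N) \<in> borel_measurable borel"
    if "N \<in> space (prob_algebra borel)" for N
  proof -
    interpret N: prob_space N using that by (simp add: in_prob_borel)
    have [measurable_cong]: "sets N = sets borel" using that by (simp add: in_prob_borel)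
    have "(\<lambda>x. \<integral>y. noise_avg f (fst (x, y)) (snd (x, y)) \<partial>N) \<in> borel_measurable borel"
         "(\<lambda>y. \<integral>x. noise_avg f (fst (x, y)) (snd (x, y)) \<partial>N) \<in> borel_measurable borel"
      by measurable
    then show "(\<lambda>x. \<integral>y. noise_avg f x y \<partial>N) \<in> borel_measurable borel" "(\<lambda>y. \<integral>x. noise_avg f x y \<partial>N) \<in> borel_measurable borel"
      by simp_all
  qed
  have le: "\<bar>\<integral>y. noise_avg f x y \<partial>N\<bar> \<le> B" "\<bar>\<integral>x. noise_avg f x y \<partial>N\<bar> \<le> B" if "N \<in> space (prob_algebra borel)" for N x y
    using that by (auto simp: in_prob_borel intro!: abs_integral_le_prob abs_avg_le B)
  have "(\<integral>z. f z \<partial>gain lam mu ?M ?M) = (\<integral>x. \<integral>y. noise_avg f x y \<partial>?M \<partial>?M)"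
    by (rule integral_gain_bounded(1)[OF M M f B])
  also have "\<dots> = (\<integral>j. \<integral>x. \<integral>y. noise_avg f x y \<partial>?M \<partial>K j \<partial>measure_pmf p)"
    by (rule integral_bind_pmf[OF K m(1)[OF M] le(1)[OF M]])
  also have "\<dots> = (\<integral>j. \<integral>y. \<integral>x. noise_avg f x y \<partial>K j \<partial>?M \<partial>measure_pmf p)"
    using integral_gain_bounded[OF K M f B] by simp
  also have "\<dots> = (\<integral>j. \<integral>k. \<integral>y. \<integral>x. noise_avg f x y \<partial>K j \<partial>K k \<partial>measure_pmf p \<partial>measure_pmf p)"
    by (intro Bochner_Integration.integral_cong refl integral_bind_pmf[OF K m(2)[OF K] le(2)[OF K]])
  also have "\<dots> = (\<integral>j. \<integral>k. \<integral>z. f z \<partial>gain lam mu (K j) (K k) \<partial>measure_pmf p \<partial>measure_pmf p)"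
    by (simp add: integral_gain_bounded(2)[OF K K f B])
  finally show ?thesis .
qed

text \<open>
  For \<open>z = 1 - exp (- t)\<close>, the integral of \<open>f\<close> against the Wild sum is \<open>exp (- t)\<close> times the power
  series in \<open>z\<close> whose coefficients are the integrals against the Wild terms. The factor
  \<open>exp (- t)\<close> differentiates to the loss term. The recursion turns the derived series into the
  diagonal sums of the collision integrals, which form the gain term by bilinearity.
\<close>

lemma wild_sum_derivative:
  fixes f :: "'a::euclidean_space \<Rightarrow> real"
  assumes P: "P \<in> space (prob_algebra borel)"
    and f: "f \<in> borel_measurable borel" and B: "\<And>x. \<bar>f x\<bar> \<le> B" and t: "0 \<le> t"
  shows "((\<lambda>s. \<integral>x. f x \<partial>wild_sum lam mu P s) has_real_derivative
     (\<integral>x. f x \<partial>gain lam mu (wild_sum lam mu P t) (wild_sum lam mu P t)) - (\<integral>x. f x \<partial>wild_sum lam mu P t))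
     (at t within {0..})"
proof -
  note W = wild_in_prob[OF P]
  define a where "a n = (\<integral>x. f x \<partial>wild lam mu P n)" for n
  define G where "G j k = (\<integral>x. f x \<partial>gain lam mu (wild lam mu P j) (wild lam mu P k))" for j k
  have aB: "\<bar>a n\<bar> \<le> B" for n
    unfolding a_def using W by (auto simp: in_prob_borel intro!: abs_integral_le_prob B)
  have GB: "\<bar>G j k\<bar> \<le> B" for j k
    unfolding G_def using gain_in_prob[OF W W] by (auto simp: in_prob_borel intro!: abs_integral_le_prob B)
  have I: "(\<integral>x. f x \<partial>wild_sum lam mu P s) = exp (-s) * (\<Sum>n. a n * (1 - exp (-s))^n)" if "0 \<le> s" for s
    unfolding wild_sum_def integral_bind_pmf[OF W f B] a_def[symmetric]
    using that by (intro geometric_expectation[where B=B] aB) auto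
  have aG: "diffs a n = (\<Sum>j\<le>n. G j (n - j))" for n
    unfolding diffs_def a_def G_def integral_wild_Suc[OF P f B, symmetric] by simp
  let ?z = "1 - exp (- t)"
  have z: "0 \<le> ?z" "?z < 1" using t by auto
  have row: "\<bar>exp (-t) * (\<Sum>k. G j k * ?z^k)\<bar> \<le> B" for j
    using t by (subst geometric_expectation[symmetric, where B=B])
       (auto intro!: GB abs_integral_le_prob measure_pmf.prob_space_axioms)
  have summ: "summable (\<lambda>j. (\<Sum>k. G j k * ?z^k) * ?z^j)"
  proof (rule summable_comparison_test)
    have "\<bar>\<Sum>k. G j k * ?z^k\<bar> \<le> exp t * B" for j
      using row[of j] by (simp add: abs_mult exp_minus field_simps)
    then show "\<exists>N. \<forall>j\<ge>N. norm ((\<Sum>k. G j k * ?z^k) * ?z^j) \<le> exp t * B * ?z^j"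
      using z(1) by (auto simp: abs_mult intro!: mult_right_mono)
    show "summable (\<lambda>j. exp t * B * ?z^j)"
      using z by (intro summable_mult summable_geometric) auto
  qed
  have "(\<integral>x. f x \<partial>gain lam mu (wild_sum lam mu P t) (wild_sum lam mu P t))
     = (\<integral>j. \<integral>k. G j k \<partial>geometric_pmf (exp (-t)) \<partial>geometric_pmf (exp (-t)))"
    unfolding wild_sum_def G_def by (rule integral_gain_bind_pmf[OF W f B])
  also have "\<dots> = (\<integral>j. exp (-t) * (\<Sum>k. G j k * ?z^k) \<partial>geometric_pmf (exp (-t)))"
    using t by (subst geometric_expectation[where B=B]) (auto intro!: GB)
  also have "\<dots> = exp (-t) * (\<Sum>j. exp (-t) * (\<Sum>k. G j k * ?z^k) * ?z^j)"
    using t row by (intro geometric_expectation[where B=B]) auto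
  also have "(\<Sum>j. exp (-t) * (\<Sum>k. G j k * ?z^k) * ?z^j) = exp (-t) * (\<Sum>j. (\<Sum>k. G j k * ?z^k) * ?z^j)"
    using summ by (simp add: mult.assoc suminf_mult)
  also have "(\<Sum>j. (\<Sum>k. G j k * ?z^k) * ?z^j) = (\<Sum>n. diffs a n * ?z^n)"
    unfolding aG by (rule suminf_triangle[OF z GB, symmetric])
  finally have gain: "(\<integral>x. f x \<partial>gain lam mu (wild_sum lam mu P t) (wild_sum lam mu P t))
      = exp (-t) * (exp (-t) * (\<Sum>n. diffs a n * ?z^n))" .
  have "((\<lambda>z. \<Sum>n. a n * z^n) has_field_derivative (\<Sum>n. diffs a n * ?z^n)) (at ?z)"
  proof (rule termdiffs_strong'[where K=1])
    fix y :: real assume "norm y < 1"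
    then have "summable (\<lambda>n. B * norm y^n)" by (intro summable_mult summable_geometric) auto
    then show "summable (\<lambda>n. a n * y^n)"
      by (rule summable_comparison_test[rotated]) (auto simp: abs_mult power_abs intro!: mult_right_mono aB)
  qed (use z in auto)
  then have F: "((\<lambda>s. \<Sum>n. a n * (1 - exp (-s))^n) has_real_derivative (\<Sum>n. diffs a n * ?z^n) * exp (-t)) (at t within {0..})"
    by (rule DERIV_chain2) (auto intro!: derivative_eq_intros)
  have "((\<lambda>s. exp (-s) * (\<Sum>n. a n * (1 - exp (-s))^n)) has_real_derivative
     (\<integral>x. f x \<partial>gain lam mu (wild_sum lam mu P t) (wild_sum lam mu P t)) - (\<integral>x. f x \<partial>wild_sum lam mu P t)) (at t within {0..})"
    unfolding gain I[OF t]
    by (rule derivative_eq_intros F refl)+ (simp add: algebra_simps)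
  then show ?thesis
    by (rule has_field_derivative_transform_within[OF _ zero_less_one]) (use t I in auto)
qed

end

context random_collision
begin

lemma weak_evolution_distr_wild_sum:
  fixes P :: "'a::euclidean_space measure" and L :: "'a \<Rightarrow> real"
  assumes P: "P \<in> space (prob_algebra borel)" and L: "bounded_linear L"
  shows "weak_evolution lam mu (\<lambda>t. distr (wild_sum lam mu P t) borel L)"
  unfolding weak_evolution_def
proof (intro conjI allI impI)
  note W = wild_sum_in_prob[OF P]
  have Lm [measurable]: "L \<in> borel_measurable borel"
    using L by (intro borel_measurable_continuous_onI linear_continuous_on)
  have Lw [measurable]: "L \<in> borel_measurable (wild_sum lam mu P t)" for t
    using W[of t] by (simp add: in_prob_borel cong: measurable_cong_sets)
  show D: "distr (wild_sum lam mu P t) borel L \<in> space (prob_algebra borel)" for t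
    using W[of t] by (auto simp: in_prob_borel intro!: prob_space.prob_space_distr)
  fix \<phi> :: "real \<Rightarrow> real" and t :: real
  assume \<phi>: "continuous_on UNIV \<phi> \<and> bounded (range \<phi>)" and t: "0 \<le> t"
  then obtain B where B: "\<And>x. \<bar>\<phi> x\<bar> \<le> B" by (auto simp: bounded_iff)
  have \<phi>m [measurable]: "\<phi> \<in> borel_measurable borel"
    using \<phi> by (auto intro: borel_measurable_continuous_onI)
  let ?W = "wild_sum lam mu P t"
  have "((\<lambda>s. \<integral>x. \<phi> (L x) \<partial>wild_sum lam mu P s) has_real_derivative
     (\<integral>x. \<phi> (L x) \<partial>gain lam mu ?W ?W) - (\<integral>x. \<phi> (L x) \<partial>?W)) (at t within {0..})"
    by (rule wild_sum_derivative[OF P _ B t]) measurable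
  moreover have "(\<integral>x. \<phi> (L x) \<partial>gain lam mu ?W ?W) = (\<integral>x. \<phi> x \<partial>distr (gain lam mu ?W ?W) borel L)"
    by (subst integral_distr) (auto simp: gain_def)
  ultimately show "((\<lambda>s. \<integral>v. \<phi> v \<partial>distr (wild_sum lam mu P s) borel L) has_real_derivative
      collision_weak lam mu (distr ?W borel L) \<phi>) (at t within {0..})"
    by (simp add: collision_weak_eq[OF D \<phi>m B] gain_distr_linear[OF W W L] integral_distr)
qed

lemma weak_evolution_eq_distr_wild_sum:
  fixes P :: "'a::euclidean_space measure" and L :: "'a \<Rightarrow> real"
  assumes P: "P \<in> space (prob_algebra borel)" and L: "bounded_linear L"
    and F: "weak_evolution lam mu F" and init: "F 0 = distr P borel L" and t: "0 \<le> t"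
  shows "F t = distr (wild_sum lam mu P t) borel L"
  by (rule weak_evolution_unique[OF F weak_evolution_distr_wild_sum[OF P L] _ t])
     (simp add: init wild_sum_0[OF P])

end

section \<open>Second moments of centred linear functionals\<close>

definition centred :: "('a \<Rightarrow> real) \<Rightarrow> real \<Rightarrow> 'a measure \<Rightarrow> bool" where
  "centred U v M \<longleftrightarrow> integrable M U \<and> (\<integral>x. U x \<partial>M) = 0 \<and> integrable M (\<lambda>x. (U x)\<^sup>2) \<and> (\<integral>x. (U x)\<^sup>2 \<partial>M) = v"

lemma centred_nonneg: "centred U v M \<Longrightarrow> 0 \<le> v"
  by (auto simp: centred_def)

lemma centred_nn_integral: "centred U v M \<Longrightarrow> (\<integral>\<^sup>+x. ennreal ((U x)\<^sup>2) \<partial>M) = ennreal v"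
  by (subst nn_integral_eq_integral) (auto simp: centred_def)

text \<open>
  Mean zero in terms of nonnegative integrals, because these are linear in the mixture even for an
  unbounded \<open>U\<close>.
\<close>

lemma centred_parts:
  assumes "centred U v M" shows "(\<integral>\<^sup>+x. ennreal (U x) \<partial>M) = (\<integral>\<^sup>+x. ennreal (- U x) \<partial>M)"
proof -
  have fin: "(\<integral>\<^sup>+x. ennreal (U x) \<partial>M) \<noteq> \<infinity>" "(\<integral>\<^sup>+x. ennreal (- U x) \<partial>M) \<noteq> \<infinity>"
    and "integrable M U" "(\<integral>x. U x \<partial>M) = 0"
    using assms by (auto simp: centred_def real_integrable_def)
  then have "enn2real (\<integral>\<^sup>+x. ennreal (U x) \<partial>M) = enn2real (\<integral>\<^sup>+x. ennreal (- U x) \<partial>M)"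
    by (simp add: real_lebesgue_integral_def)
  then show ?thesis using fin by (metis ennreal_enn2real_if infinity_ennreal_def)
qed

lemma centredI:
  assumes M: "prob_space M" and U: "U \<in> borel_measurable M"
    and sq: "(\<integral>\<^sup>+x. ennreal ((U x)\<^sup>2) \<partial>M) = ennreal v" and v: "0 \<le> v"
    and mean: "integrable M U \<Longrightarrow> (\<integral>x. U x \<partial>M) = 0"
  shows "centred U v M"
proof -
  interpret prob_space M by fact
  have i2: "integrable M (\<lambda>x. (U x)\<^sup>2)"
    using U sq by (intro integrableI_nonneg) auto
  then have "integrable M U"
    by (rule square_integrable_imp_integrable[OF U])
  moreover have "(\<integral>x. (U x)\<^sup>2 \<partial>M) = v"
    using i2 sq v by (subst integral_eq_nn_integral) auto
  ultimately show ?thesis using i2 mean by (simp add: centred_def)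
qed

lemma centred_uniform_mixture:
  fixes U :: "'a::topological_space \<Rightarrow> real"
  assumes K: "\<And>n. K n \<in> space (prob_algebra borel)" and U: "U \<in> borel_measurable borel"
    and c: "\<And>j. j \<le> n \<Longrightarrow> centred U (v j) (K j)"
  shows "centred U ((\<Sum>j\<le>n. v j) / real (Suc n)) (measure_pmf (pmf_of_set {..n}) \<bind> K)"
    (is "centred U _ ?M")
proof (rule centredI)
  have M: "prob_space ?M" "sets ?M = sets borel"
    using bind_pmf_in_prob[OF K, of "pmf_of_set {..n}"] by (auto simp: in_prob_borel)
  show "prob_space ?M" by fact
  show "U \<in> borel_measurable ?M" using U M(2) by (simp cong: measurable_cong_sets)
  have nn: "(\<integral>\<^sup>+x. h x \<partial>?M) = (\<Sum>j\<le>n. \<integral>\<^sup>+x. h x \<partial>K j) / of_nat (Suc n)" if "h \<in> borel_measurable borel" for h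
    by (subst nn_integral_bind[OF that kernel_measurable[OF K]], subst nn_integral_pmf_of_set) auto
  have v: "0 \<le> v j" if "j \<le> n" for j using centred_nonneg[OF c[OF that]] .
  have "(\<integral>\<^sup>+x. ennreal ((U x)\<^sup>2) \<partial>?M) = (\<Sum>j\<le>n. ennreal (v j)) / of_nat (Suc n)"
    using U by (subst nn) (auto intro!: sum.cong arg_cong2[where f="(/)"] centred_nn_integral c)
  also have "(\<Sum>j\<le>n. ennreal (v j)) = ennreal (\<Sum>j\<le>n. v j)"
    using v by (intro sum_ennreal) auto
  also have "\<dots> / of_nat (Suc n) = ennreal ((\<Sum>j\<le>n. v j) / real (Suc n))"
    unfolding ennreal_of_nat_eq_real_of_nat using v by (intro divide_ennreal sum_nonneg) auto
  finally show "(\<integral>\<^sup>+x. ennreal ((U x)\<^sup>2) \<partial>?M) = ennreal ((\<Sum>j\<le>n. v j) / real (Suc n))" .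
  show "0 \<le> (\<Sum>j\<le>n. v j) / real (Suc n)" using v by (intro divide_nonneg_nonneg sum_nonneg) auto
  assume int: "integrable ?M U"
  have "(\<integral>\<^sup>+x. ennreal (U x) \<partial>?M) = (\<integral>\<^sup>+x. ennreal (- U x) \<partial>?M)"
    using U by (subst (1 2) nn) (auto intro!: sum.cong arg_cong2[where f="(/)"] centred_parts c)
  then show "(\<integral>x. U x \<partial>?M) = 0"
    using int by (simp add: real_lebesgue_integral_def)
qed

text \<open>
  The recursion for the second moments of the Wild terms, solved by the coefficients of
  \<open>(1 - z) powr (- s)\<close>.
\<close>

lemma sum_pochhammer_fact:
  fixes s :: real
  shows "s * (\<Sum>j\<le>n. pochhammer s j / fact j) = real (Suc n) * (pochhammer s (Suc n) / fact (Suc n))"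
proof (induction n)
  case (Suc n)
  have "s * (\<Sum>j\<le>Suc n. pochhammer s j / fact j)
     = real (Suc n) * (pochhammer s (Suc n) / fact (Suc n)) + s * (pochhammer s (Suc n) / fact (Suc n))"
    using Suc by (simp add: distrib_left)
  also have "\<dots> = pochhammer s (Suc (Suc n)) / fact (Suc n)"
    unfolding pochhammer_Suc[of s "Suc n"] by (simp add: add_divide_distrib distrib_left mult.commute del: fact_Suc of_nat_Suc)
  also have "\<dots> = real (Suc (Suc n)) * (pochhammer s (Suc (Suc n)) / fact (Suc (Suc n)))"
    unfolding fact_Suc[of "Suc n"] by (simp del: fact_Suc pochhammer_Suc of_nat_Suc)
  finally show ?case .
qed simp

locale centred_collision = random_collision +
  assumes noise_mean: "integrable mu (\<lambda>\<eta>. \<eta>)" "(\<integral>\<eta>. \<eta> \<partial>mu) = 0"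
    and noise_sq: "integrable mu (\<lambda>\<eta>. \<eta>\<^sup>2)"
begin

definition energy_factor :: real where "energy_factor = (\<integral>\<eta>. (lam + \<eta>)\<^sup>2 \<partial>mu) + (1 - lam)\<^sup>2"

text \<open>
  Expanding the square of \<open>(lam + \<eta>) U x + (1 - lam) U y\<close>, the mixed term integrates to
  \<open>2 lam (1 - lam)\<close> times the product of the means of \<open>U\<close> under \<open>M\<close> and \<open>N\<close>, which is 0.
\<close>

lemma centred_gain:
  fixes U :: "'a::euclidean_space \<Rightarrow> real"
  assumes MN: "M \<in> space (prob_algebra borel)" "N \<in> space (prob_algebra borel)"
    and U: "bounded_linear U" and cM: "centred U v M" and cN: "centred U w N"
  shows "centred U ((\<integral>\<eta>. (lam + \<eta>)\<^sup>2 \<partial>mu) * v + (1 - lam)\<^sup>2 * w) (gain lam mu M N)"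
proof (rule centredI)
  interpret U: bounded_linear U by fact
  interpret M: prob_space M using MN by (simp add: in_prob_borel)
  interpret N: prob_space N using MN by (simp add: in_prob_borel)
  interpret mu: prob_space mu by (rule mu_prob)
  have [measurable_cong]: "sets M = sets borel" "sets N = sets borel"
    using MN by (auto simp: in_prob_borel)
  have Um [measurable]: "U \<in> borel_measurable borel"
    by (intro borel_measurable_continuous_onI U.continuous_on continuous_on_id)
  let ?A = "\<integral>\<eta>. (lam + \<eta>)\<^sup>2 \<partial>mu"
  have A: "integrable mu (\<lambda>\<eta>. (lam + \<eta>)\<^sup>2)"
    unfolding power2_sum using noise_mean noise_sq by auto
  have i1: "integrable mu (\<lambda>\<eta>. lam + \<eta>)" and l: "(\<integral>\<eta>. lam + \<eta> \<partial>mu) = lam"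
    using noise_mean by (auto simp: mu.prob_space)
  have sq: "((lam + \<eta>) * a + (1 - lam) * b)\<^sup>2 = (lam + \<eta>)\<^sup>2 * a\<^sup>2 + (lam + \<eta>) * (2 * (1 - lam) * a * b) + (1 - lam)\<^sup>2 * b\<^sup>2"
    for a b \<eta> by (simp add: power2_eq_square algebra_simps)
  have isq: "integrable mu (\<lambda>\<eta>. ((lam + \<eta>) * a + (1 - lam) * b)\<^sup>2)" for a b
    unfolding sq using A i1 by auto
  have Isq: "(\<integral>\<eta>. ((lam + \<eta>) * a + (1 - lam) * b)\<^sup>2 \<partial>mu) = ?A * a\<^sup>2 + lam * (2 * (1 - lam) * a * b) + (1 - lam)\<^sup>2 * b\<^sup>2" for a b
    unfolding sq using A i1 by (simp add: l mu.prob_space)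
  have nonneg: "0 \<le> ?A * a\<^sup>2 + lam * (2 * (1 - lam) * a * b) + (1 - lam)\<^sup>2 * b\<^sup>2" for a b
    unfolding Isq[symmetric] by simp
  have v: "0 \<le> v" "0 \<le> w" "0 \<le> ?A" using cM cN by (auto simp: centred_nonneg)
  have G: "gain lam mu M N \<in> space (prob_algebra borel)" by (rule gain_in_prob[OF MN])
  then show "prob_space (gain lam mu M N)" by (simp add: in_prob_borel)
  show "U \<in> borel_measurable (gain lam mu M N)" by (simp add: gain_def)
  have y: "(\<integral>\<^sup>+y. ennreal (?A * a\<^sup>2 + lam * (2 * (1 - lam) * a * U y) + (1 - lam)\<^sup>2 * (U y)\<^sup>2) \<partial>N) = ennreal (?A * a\<^sup>2 + (1 - lam)\<^sup>2 * w)" for a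
    using cN nonneg by (subst nn_integral_eq_integral) (auto simp: centred_def N.prob_space)
  have inner: "(\<integral>\<^sup>+\<eta>. ennreal (((lam + \<eta>) * a + (1 - lam) * b)\<^sup>2) \<partial>mu)
      = ennreal (?A * a\<^sup>2 + lam * (2 * (1 - lam) * a * b) + (1 - lam)\<^sup>2 * b\<^sup>2)" for a b
    by (subst nn_integral_eq_integral[OF isq]) (auto simp only: Isq zero_le_power2 intro: AE_I2)
  have "(\<integral>\<^sup>+z. ennreal ((U z)\<^sup>2) \<partial>gain lam mu M N)
     = (\<integral>\<^sup>+x. \<integral>\<^sup>+y. \<integral>\<^sup>+\<eta>. ennreal (((lam + \<eta>) * U x + (1 - lam) * U y)\<^sup>2) \<partial>mu \<partial>N \<partial>M)"
    by (subst nn_integral_gain[OF MN]) (auto simp: U.add U.scaleR)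
  also have "\<dots> = (\<integral>\<^sup>+x. ennreal (?A * (U x)\<^sup>2 + (1 - lam)\<^sup>2 * w) \<partial>M)"
    by (simp only: inner y)
  also have "\<dots> = ennreal (?A * v + (1 - lam)\<^sup>2 * w)"
    using cM v by (subst nn_integral_eq_integral) (auto simp: centred_def M.prob_space)
  finally show "(\<integral>\<^sup>+z. ennreal ((U z)\<^sup>2) \<partial>gain lam mu M N) = ennreal (?A * v + (1 - lam)\<^sup>2 * w)" .
  show "0 \<le> ?A * v + (1 - lam)\<^sup>2 * w" using v by simp
  assume int: "integrable (gain lam mu M N) U"
  have "(\<integral>z. U z \<partial>gain lam mu M N) = (\<integral>x. lam * U x \<partial>M)"
    unfolding integral_gain(1)[OF MN int]
  proof (rule integral_cong_AE)
    interpret Nmu: pair_prob_space N mu ..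
    show "(\<lambda>x. \<integral>w. U ((lam + snd w) *\<^sub>R x + (1 - lam) *\<^sub>R fst w) \<partial>(N \<Otimes>\<^sub>M mu)) \<in> borel_measurable M"
      by measurable
    show "(\<lambda>x. lam * U x) \<in> borel_measurable M" by measurable
    have "(\<integral>y. \<integral>\<eta>. U ((lam + \<eta>) *\<^sub>R x + (1 - lam) *\<^sub>R y) \<partial>mu \<partial>N) = lam * U x" for x
      using cN i1 by (simp add: U.add U.scaleR l mu.prob_space N.prob_space centred_def)
    then show "AE x in M. (\<integral>w. U ((lam + snd w) *\<^sub>R x + (1 - lam) *\<^sub>R fst w) \<partial>(N \<Otimes>\<^sub>M mu)) = lam * U x"
      using integral_gain(2)[OF MN int] by simp
  qed
  then show "(\<integral>z. U z \<partial>gain lam mu M N) = 0"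
    using cM by (simp add: centred_def)
qed

lemma centred_wild:
  fixes U :: "'a::euclidean_space \<Rightarrow> real"
  assumes P: "P \<in> space (prob_algebra borel)" and U: "bounded_linear U" and c: "centred U v P"
  shows "centred U (pochhammer energy_factor n / fact n * v) (wild lam mu P n)"
proof (induction n rule: less_induct)
  case (less n)
  show ?case
  proof (cases n)
    case 0 then show ?thesis using c by simp
  next
    case (Suc m)
    let ?c = "\<lambda>j. pochhammer energy_factor j / fact j"
    let ?A = "\<integral>\<eta>. (lam + \<eta>)\<^sup>2 \<partial>mu"
    let ?K = "\<lambda>j. if j \<le> m then gain lam mu (wild lam mu P j) (wild lam mu P (m - j)) else P"
    have Um: "U \<in> borel_measurable borel"
      using U by (intro borel_measurable_continuous_onI linear_continuous_on)
    have K: "?K j \<in> space (prob_algebra borel)" for j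
      using P by (auto intro!: gain_in_prob wild_in_prob)
    have "centred U (?A * (?c j * v) + (1 - lam)\<^sup>2 * (?c (m - j) * v)) (?K j)" if "j \<le> m" for j
    proof -
      have "centred U (?A * (?c j * v) + (1 - lam)\<^sup>2 * (?c (m - j) * v)) (gain lam mu (wild lam mu P j) (wild lam mu P (m - j)))"
        using that Suc by (intro centred_gain wild_in_prob P U less) auto
      then show ?thesis using that by (simp only: if_True)
    qed
    from centred_uniform_mixture[OF K Um this]
    have "centred U ((\<Sum>j\<le>m. ?A * (?c j * v) + (1 - lam)\<^sup>2 * (?c (m - j) * v)) / real (Suc m)) (wild lam mu P n)"
      by (simp add: Suc)
    also have "(\<Sum>j\<le>m. ?A * (?c j * v) + (1 - lam)\<^sup>2 * (?c (m - j) * v))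
       = ?A * v * (\<Sum>j\<le>m. ?c j) + (1 - lam)\<^sup>2 * v * (\<Sum>j\<le>m. ?c (m - j))"
      by (simp add: sum.distrib sum_distrib_left mult_ac)
    also have "(\<Sum>j\<le>m. ?c (m - j)) = (\<Sum>j\<le>m. ?c j)"
      using sum.nat_diff_reindex[of ?c "Suc m"] by (simp add: lessThan_Suc_atMost)
    also have "?A * v * (\<Sum>j\<le>m. ?c j) + (1 - lam)\<^sup>2 * v * (\<Sum>j\<le>m. ?c j) = v * (energy_factor * (\<Sum>j\<le>m. ?c j))"
      by (simp add: energy_factor_def algebra_simps)
    also have "\<dots> = real (Suc m) * (?c n * v)"
      unfolding sum_pochhammer_fact by (simp add: Suc)
    finally show ?thesis by simp
  qed
qed

text \<open>
  The moments of the Wild terms add up to a binomial series, whose value is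
  \<open>exp (- t) powr (- energy_factor)\<close>; the remaining factor \<open>exp (- t)\<close> comes from the geometric
  weights.
\<close>

lemma wild_sum_second_moment:
  fixes U :: "'a::euclidean_space \<Rightarrow> real"
  assumes P: "P \<in> space (prob_algebra borel)" and U: "bounded_linear U" and c: "centred U v P"
    and t: "0 \<le> t"
  shows "(\<integral>\<^sup>+x. ennreal ((U x)\<^sup>2) \<partial>wild_sum lam mu P t) = ennreal (exp ((energy_factor - 1) * t) * v)"
proof -
  have Um: "U \<in> borel_measurable borel"
    using U by (intro borel_measurable_continuous_onI linear_continuous_on)
  let ?z = "1 - exp (- t)"
  let ?c = "\<lambda>j. pochhammer energy_factor j / fact j"
  have "0 \<le> energy_factor" by (simp add: energy_factor_def)
  then have c0: "0 \<le> ?c n" for n by (auto simp: pochhammer_prod intro!: prod_nonneg divide_nonneg_nonneg)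
  have v: "0 \<le> v" using c by (rule centred_nonneg)
  have z: "0 \<le> ?z" "?z < 1" using t by auto
  have "(\<integral>\<^sup>+x. ennreal ((U x)\<^sup>2) \<partial>wild_sum lam mu P t)
     = (\<integral>\<^sup>+n. \<integral>\<^sup>+x. ennreal ((U x)\<^sup>2) \<partial>wild lam mu P n \<partial>geometric_pmf (exp (-t)))"
    unfolding wild_sum_def using Um
    by (intro nn_integral_bind[OF _ kernel_measurable[OF wild_in_prob[OF P]]]) auto
  also have "\<dots> = (\<Sum>n. ennreal (pmf (geometric_pmf (exp (-t))) n) * ennreal (?c n * v))"
    by (simp only: centred_nn_integral[OF centred_wild[OF P U c]] nn_integral_measure_pmf nn_integral_count_space_nat)
  also have "\<dots> = (\<Sum>n. ennreal (exp (-t) * v * (?c n * ?z^n)))"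
  proof (rule suminf_cong)
    fix n
    have "ennreal (pmf (geometric_pmf (exp (-t))) n) * ennreal (?c n * v)
        = ennreal (pmf (geometric_pmf (exp (-t))) n * (?c n * v))"
      using c0[of n] v by (intro ennreal_mult[symmetric] mult_nonneg_nonneg) auto
    also have "pmf (geometric_pmf (exp (-t))) n * (?c n * v) = exp (-t) * v * (?c n * ?z^n)"
      using t by simp
    finally show "ennreal (pmf (geometric_pmf (exp (-t))) n) * ennreal (?c n * v)
        = ennreal (exp (-t) * v * (?c n * ?z^n))" .
  qed
  also have "\<dots> = ennreal (exp (-t) * v * exp (-t) powr (- energy_factor))"
  proof (rule suminf_ennreal_eq)
    have binomial: "(- energy_factor gchoose n) * (- w)^n = ?c n * w^n" for n and w :: real
      by (simp add: gbinomial_pochhammer mult_ac flip: power_mult_distrib)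
    have "(\<lambda>n. (- energy_factor gchoose n) * (- ?z)^n) sums (1 + - ?z) powr (- energy_factor)"
      using z by (intro gen_binomial_real) auto
    also have "(\<lambda>n. (- energy_factor gchoose n) * (- ?z)^n) = (\<lambda>n. ?c n * ?z^n)"
      unfolding binomial ..
    finally show "(\<lambda>n. exp (-t) * v * (?c n * ?z^n)) sums (exp (-t) * v * exp (-t) powr (- energy_factor))"
      by (intro sums_mult) simp
    show "0 \<le> exp (-t) * v * (?c n * ?z^n)" for n
      using c0[of n] v z by (intro mult_nonneg_nonneg) auto
  qed
  also have "exp (-t) * v * exp (-t) powr (- energy_factor) = exp ((energy_factor - 1) * t) * v"
    by (simp add: powr_def exp_add[symmetric] algebra_simps flip: exp_add)
  finally show ?thesis .
qed

end

section \<open>The Wasserstein distance\<close>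

lemma coupling_in_prob:
  "\<pi> \<in> couplings f g \<Longrightarrow> \<pi> \<in> space (prob_algebra borel)"
  unfolding couplings_def in_prob_borel borel_prod by simp

lemma coupling_measurable:
  fixes \<pi> :: "(real \<times> real) measure"
  assumes "\<pi> \<in> space (prob_algebra borel)"
  shows "fst \<in> borel_measurable \<pi>" "snd \<in> borel_measurable \<pi>"
proof -
  have "measurable \<pi> borel = measurable (borel \<Otimes>\<^sub>M borel) (borel :: real measure)"
    using assms unfolding in_prob_borel borel_prod by (intro measurable_cong_sets) auto
  then show "fst \<in> borel_measurable \<pi>" "snd \<in> borel_measurable \<pi>" by simp_all
qed

lemma coupling_integrable:
  assumes \<pi>: "\<pi> \<in> couplings f g" and f: "f \<in> P2" and g: "g \<in> P2"
  shows "integrable \<pi> fst" "integrable \<pi> snd" "integrable \<pi> (\<lambda>p. (fst p - snd p)\<^sup>2)"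
proof -
  note P = coupling_in_prob[OF \<pi>]
  note [measurable] = coupling_measurable[OF P]
  interpret \<pi>: prob_space \<pi> using P by (simp add: in_prob_borel)
  have fg: "f = distr \<pi> borel fst" "g = distr \<pi> borel snd"
    using \<pi> by (auto simp: couplings_def)
  have sq: "integrable \<pi> (\<lambda>p. (fst p)\<^sup>2)" "integrable \<pi> (\<lambda>p. (snd p)\<^sup>2)"
    using f g unfolding fg P2_def by (auto simp: integrable_distr_eq)
  show "integrable \<pi> fst" "integrable \<pi> snd"
    using sq by (auto intro: \<pi>.square_integrable_imp_integrable)
  show "integrable \<pi> (\<lambda>p. (fst p - snd p)\<^sup>2)"
  proof (rule Bochner_Integration.integrable_bound)
    show "integrable \<pi> (\<lambda>p. 2 * (fst p)\<^sup>2 + 2 * (snd p)\<^sup>2)" using sq by auto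
    have "(a - b)\<^sup>2 \<le> 2 * a\<^sup>2 + 2 * b\<^sup>2" for a b :: real
      using zero_le_power2[of "a + b"] by (simp add: power2_eq_square algebra_simps)
    then show "AE p in \<pi>. norm ((fst p - snd p)\<^sup>2) \<le> norm (2 * (fst p)\<^sup>2 + 2 * (snd p)\<^sup>2)" by simp
  qed measurable
qed

context centred_collision
begin

text \<open>
  Every coupling of the initial data evolves into a coupling at time \<open>t\<close> whose cost is known exactly.
  To pass to the infimum over the initial coupling, the exponential factor is first moved to the left.
\<close>

lemma W2_contraction:
  assumes f01: "f01 \<in> P2" and f02: "f02 \<in> P2" and mean: "(\<integral>v. v \<partial>f01) = (\<integral>v. v \<partial>f02)"
    and F1: "weak_evolution lam mu F1" "F1 0 = f01" and F2: "weak_evolution lam mu F2" "F2 0 = f02"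
    and t: "0 \<le> t"
  shows "W2 (F1 t) (F2 t) \<le> ennreal (exp ((energy_factor - 1) * t / 2)) * W2 f01 f02"
proof -
  let ?k = "exp ((energy_factor - 1) * t / 2)"
  have "W2 (F1 t) (F2 t) * ennreal (1 / ?k) \<le> W2 f01 f02"
    unfolding W2_def[of f01 f02]
  proof (rule INF_greatest)
    fix \<pi> assume \<pi>: "\<pi> \<in> couplings f01 f02"
    then have P: "\<pi> \<in> space (prob_algebra borel)" and f: "f01 = distr \<pi> borel fst" "f02 = distr \<pi> borel snd"
      using coupling_in_prob[OF \<pi>] by (auto simp: couplings_def)
    note [measurable] = coupling_measurable[OF P]
    have sqrt_exp: "sqrt (exp ((energy_factor - 1) * t)) = ?k"
      by (rule real_sqrt_unique) (auto simp: power2_eq_square simp flip: exp_add)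
    let ?U = "\<lambda>p. fst p - snd p :: real"
    have "(\<integral>p. fst p \<partial>\<pi>) = (\<integral>p. snd p \<partial>\<pi>)"
      using mean unfolding f by (simp add: integral_distr)
    then have c: "centred ?U (\<integral>p. (?U p)\<^sup>2 \<partial>\<pi>) \<pi>"
      using coupling_integrable[OF \<pi> f01 f02] by (simp add: centred_def)
    let ?v = "\<integral>p. (?U p)\<^sup>2 \<partial>\<pi>"
    let ?Q = "wild_sum lam mu \<pi> t"
    have Q: "?Q \<in> space (prob_algebra borel)" by (rule wild_sum_in_prob[OF P])
    have "F1 t = distr ?Q borel fst" "F2 t = distr ?Q borel snd"
      using F1 F2 t f by (auto intro!: weak_evolution_eq_distr_wild_sum[OF P] bounded_linear_fst bounded_linear_snd)
    then have "?Q \<in> couplings (F1 t) (F2 t)"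
      using Q unfolding couplings_def in_prob_borel borel_prod by simp
    then have "W2 (F1 t) (F2 t) \<le> ennreal_sqrt (\<integral>\<^sup>+(v, x). ennreal (\<bar>v - x\<bar>\<^sup>2) \<partial>?Q)"
      unfolding W2_def by (rule INF_lower)
    also have "(\<integral>\<^sup>+(v, x). ennreal (\<bar>v - x\<bar>\<^sup>2) \<partial>?Q) = ennreal (exp ((energy_factor - 1) * t) * ?v)"
      using wild_sum_second_moment[OF P bounded_linear_sub[OF bounded_linear_fst bounded_linear_snd] c t]
      by (simp add: case_prod_unfold)
    also have "ennreal_sqrt \<dots> = ennreal (?k * sqrt ?v)"
      by (simp add: ennreal_sqrt_def real_sqrt_mult sqrt_exp)
    finally have "W2 (F1 t) (F2 t) * ennreal (1 / ?k) \<le> ennreal (?k * sqrt ?v) * ennreal (1 / ?k)"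
      by (rule mult_right_mono) simp
    also have "\<dots> = ennreal (sqrt ?v)" by (simp flip: ennreal_mult')
    also have "\<dots> = ennreal_sqrt (\<integral>\<^sup>+(v, x). ennreal (\<bar>v - x\<bar>\<^sup>2) \<partial>\<pi>)"
      using centred_nn_integral[OF c] by (simp add: ennreal_sqrt_def case_prod_unfold)
    finally show "W2 (F1 t) (F2 t) * ennreal (1 / ?k) \<le> ennreal_sqrt (\<integral>\<^sup>+(v, x). ennreal (\<bar>v - x\<bar>\<^sup>2) \<partial>\<pi>)" .
  qed
  then have "ennreal ?k * (W2 (F1 t) (F2 t) * ennreal (1 / ?k)) \<le> ennreal ?k * W2 f01 f02"
    by (rule mult_left_mono) simp
  moreover have "ennreal ?k * (W2 (F1 t) (F2 t) * ennreal (1 / ?k)) = W2 (F1 t) (F2 t) * ennreal (?k * (1 / ?k))"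
    by (subst ennreal_mult) (auto simp: mult_ac)
  ultimately show ?thesis by simp
qed

end

text \<open>
  The product measure is a coupling, and its cost is finite by the second moments.
\<close>

lemma W2_finite:
  assumes "f \<in> P2" "g \<in> P2"
  shows "W2 f g < \<infinity>"
proof -
  interpret f: prob_space f using assms by (simp add: P2_def prob_halfline_def)
  interpret g: prob_space g using assms by (simp add: P2_def prob_halfline_def)
  interpret fg: pair_prob_space f g ..
  have [measurable_cong]: "sets f = sets borel" "sets g = sets borel"
    using assms by (auto simp: P2_def prob_halfline_def)
  have sets: "sets f = sets borel" "sets g = sets borel"
    using assms by (auto simp: P2_def prob_halfline_def)
  let ?\<pi> = "f \<Otimes>\<^sub>M g"
  have "distr ?\<pi> borel fst = f"
  proof (rule measure_eqI)
    fix A assume "A \<in> sets (distr ?\<pi> borel fst)"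
    then have A: "A \<in> sets borel" "A \<in> sets f" by (auto simp: sets)
    have "emeasure ?\<pi> (A \<times> space g) = emeasure f A * emeasure g (space g)"
      by (rule g.emeasure_pair_measure_Times[OF A(2) sets.top])
    moreover have "fst -` A \<inter> space ?\<pi> = A \<times> space g"
      using sets.sets_into_space[OF A(2)] by (auto simp: space_pair_measure)
    ultimately show "emeasure (distr ?\<pi> borel fst) A = emeasure f A"
      using A by (simp add: emeasure_distr g.emeasure_space_1)
  qed (simp add: sets)
  moreover have "distr ?\<pi> borel snd = g"
  proof (rule measure_eqI)
    fix A assume "A \<in> sets (distr ?\<pi> borel snd)"
    then have A: "A \<in> sets borel" "A \<in> sets g" by (auto simp: sets)
    have "emeasure ?\<pi> (space f \<times> A) = emeasure f (space f) * emeasure g A"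
      by (rule g.emeasure_pair_measure_Times[OF sets.top A(2)])
    moreover have "snd -` A \<inter> space ?\<pi> = space f \<times> A"
      using sets.sets_into_space[OF A(2)] by (auto simp: space_pair_measure)
    ultimately show "emeasure (distr ?\<pi> borel snd) A = emeasure g A"
      using A by (simp add: emeasure_distr f.emeasure_space_1)
  qed (simp add: sets)
  ultimately have \<pi>: "?\<pi> \<in> couplings f g"
    using fg.prob_space_axioms by (simp add: couplings_def sets cong: sets_pair_measure_cong)
  then have "W2 f g \<le> ennreal_sqrt (\<integral>\<^sup>+(v, x). ennreal (\<bar>v - x\<bar>\<^sup>2) \<partial>?\<pi>)"
    unfolding W2_def by (rule INF_lower)
  also have "(\<integral>\<^sup>+(v, x). ennreal (\<bar>v - x\<bar>\<^sup>2) \<partial>?\<pi>) < \<infinity>"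
    using coupling_integrable(3)[OF \<pi> assms] by (simp add: integrable_iff_bounded case_prod_unfold)
  then have "ennreal_sqrt (\<integral>\<^sup>+(v, x). ennreal (\<bar>v - x\<bar>\<^sup>2) \<partial>?\<pi>) < \<infinity>"
    by (auto simp: ennreal_sqrt_def)
  finally show ?thesis .
qed

lemma boltzmann_solution_weak_evolution:
  "boltzmann_solution lam mu f0 f \<Longrightarrow> weak_evolution lam mu f \<and> f 0 = f0"
  by (auto simp: boltzmann_solution_def weak_evolution_def prob_halfline_def in_prob_borel)

theorem theorem4p1:
  fixes lam \<beta> m :: real
    and mu f01 f02 :: "real measure"
    and f1 f2 :: "real \<Rightarrow> real measure"
  assumes lam: "0 \<le> lam" "lam \<le> 1"
    and mu_prob: "prob_space mu" "sets mu = sets borel"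
    and mu_supp: "AE \<eta> in mu. - lam \<le> \<eta>"
    and mu_mean: "integrable mu (\<lambda>\<eta>. \<eta>)" "prob_space.expectation mu (\<lambda>\<eta>. \<eta>) = 0"
    and mu_var: "integrable mu (\<lambda>\<eta>. \<eta>\<^sup>2)" "prob_space.variance mu (\<lambda>\<eta>. \<eta>) = \<beta>\<^sup>2"
    and init: "f01 \<in> P2" "f02 \<in> P2"
    and mean: "(\<integral>v. v \<partial>f01) = m" "(\<integral>v. v \<partial>f02) = m"
    and sol: "boltzmann_solution lam mu f01 f1" "boltzmann_solution lam mu f02 f2"
  shows "(\<forall>t\<ge>0. (W2 (f1 t) (f2 t))\<^sup>2
                 \<le> ennreal (exp (spectral_fun lam mu 2 * t)) * (W2 f01 f02)\<^sup>2)
       \<and> spectral_fun lam mu 2 = 2 * lam * (lam - 1) + \<beta>\<^sup>2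
       \<and> (\<beta>\<^sup>2 < 2 * lam * (1 - lam) \<longrightarrow>
            spectral_fun lam mu 2 < 0 \<and>
            (\<exists>C\<ge>0. \<exists>c>0. \<forall>t\<ge>0. W2 (f1 t) (f2 t) \<le> ennreal (C * exp (- c * t))))"
proof -
  interpret mu: prob_space mu by (rule mu_prob)
  interpret centred_collision lam mu
    using mu_prob mu_mean mu_var by unfold_locales auto
  let ?s = "spectral_fun lam mu 2"
  have "(\<integral>\<eta>. (lam + \<eta>) powr 2 \<partial>mu) = (\<integral>\<eta>. (lam + \<eta>)\<^sup>2 \<partial>mu)"
    using mu_supp by (intro integral_cong_AE) (auto simp: powr_numeral)
  then have s: "?s = energy_factor - 1"
    using lam by (simp add: spectral_fun_def energy_factor_def powr_numeral)
  have "(\<integral>\<eta>. (lam + \<eta>)\<^sup>2 \<partial>mu) = (\<integral>\<eta>. lam\<^sup>2 + \<eta>\<^sup>2 + 2 * lam * \<eta> \<partial>mu)"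
    by (simp add: power2_sum)
  also have "\<dots> = lam\<^sup>2 + \<beta>\<^sup>2"
    using mu_mean mu_var by (simp add: mu.prob_space)
  finally have s2: "?s = 2 * lam * (lam - 1) + \<beta>\<^sup>2"
    unfolding s energy_factor_def by (simp add: power2_eq_square algebra_simps)
  have W: "W2 (f1 t) (f2 t) \<le> ennreal (exp (?s * t / 2)) * W2 f01 f02" if "0 \<le> t" for t
    unfolding s using sol[THEN boltzmann_solution_weak_evolution] mean that
    by (intro W2_contraction init) auto
  have "(W2 (f1 t) (f2 t))\<^sup>2 \<le> ennreal (exp (?s * t)) * (W2 f01 f02)\<^sup>2" if "0 \<le> t" for t
  proof -
    have "(W2 (f1 t) (f2 t))\<^sup>2 \<le> (ennreal (exp (?s * t / 2)) * W2 f01 f02)\<^sup>2"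
      using W[OF that] by (intro power_mono) auto
    also have "\<dots> = ennreal (exp (?s * t)) * (W2 f01 f02)\<^sup>2"
      by (simp add: power_mult_distrib ennreal_power flip: exp_of_nat_mult)
    finally show ?thesis .
  qed
  moreover have "?s < 0 \<and> (\<exists>C\<ge>0. \<exists>c>0. \<forall>t\<ge>0. W2 (f1 t) (f2 t) \<le> ennreal (C * exp (- c * t)))"
    if "\<beta>\<^sup>2 < 2 * lam * (1 - lam)"
  proof
    show neg: "?s < 0" using that unfolding s2 by (simp add: algebra_simps)
    define C where "C = enn2real (W2 f01 f02)"
    have C: "W2 f01 f02 = ennreal C" "0 \<le> C"
      using W2_finite[OF init] by (auto simp: C_def)
    have "W2 (f1 t) (f2 t) \<le> ennreal (C * exp (- (- ?s / 2) * t))" if "0 \<le> t" for t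
      using W[OF that] C by (simp add: ennreal_mult'[symmetric] mult_ac)
    then show "\<exists>C\<ge>0. \<exists>c>0. \<forall>t\<ge>0. W2 (f1 t) (f2 t) \<le> ennreal (C * exp (- c * t))"
      using C(2) neg by (intro exI[of _ C] conjI exI[of _ "- ?s / 2"]) auto
  qed
  ultimately show ?thesis using s2 by blast
qed

end
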